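(* Let $X$ be an infinite-dimensional separable, real or complex, Banach space. There exists a continuous linear operator $R$ on $X$ such that, putting $$A_R=\{x\in X:\ \|R^t x\|\to\infty \text{ as } t\to\infty\}\quad\text{and}\quad B_R=\{x\in X:\ \liminf_{t\to\infty}\|R^t x-x\|=0\},$$ the following hold. (A) $A_R$ and $B_R$ both have non-empty interior, and $\{A_R,B_R\}$ is a partition of $X$. (B) $R$ can be written $R=I+K$, where $I$ is the identity of $X$ and $K$ is a compact operator on $X$.
   Context: Here $t$ ranges over the non-negative integers, and $R^t$ is the $t$-th iterate of $R$. *)

theory Defs
  imports "HOL-Analysis.Analysis"
begin

text \<open>
  The library's normed spaces are real, and carry no complex counterpart.  A Banach space over
  the scalar field \<open>'k\<close> (for us the reals or the complex numbers) is a type of class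
  \<^class>\<open>banach\<close> with a scalar multiplication by \<open>'k\<close> that extends the real one and for
  which the given norm is homogeneous.  For \<open>'k\<close> the reals, the only such multiplication is
  the one of the class itself.
\<close>

locale normed_space_over = vector_space smul
  for smul :: "'k::real_normed_field \<Rightarrow> 'a::real_normed_vector \<Rightarrow> 'a" +
  assumes scale_of_real: "smul (of_real r) x = r *\<^sub>R x"
    and norm_scale: "norm (smul c x) = norm c * norm x"

definition infinite_dimensional :: "('k::field \<Rightarrow> 'a::ab_group_add \<Rightarrow> 'a) \<Rightarrow> bool" where
  "infinite_dimensional smul \<longleftrightarrow> \<not> (\<exists>Basis. finite_dimensional_vector_space smul Basis)"

definition continuous_linear_operator ::
    "('k::field \<Rightarrow> 'a::real_normed_vector \<Rightarrow> 'a) \<Rightarrow> ('a \<Rightarrow> 'a) \<Rightarrow> bool" where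
  "continuous_linear_operator smul T \<longleftrightarrow>
     Vector_Spaces.linear smul smul T \<and> continuous_on UNIV T"

definition compact_operator ::
    "('k::field \<Rightarrow> 'a::real_normed_vector \<Rightarrow> 'a) \<Rightarrow> ('a \<Rightarrow> 'a) \<Rightarrow> bool" where
  "compact_operator smul K \<longleftrightarrow>
     Vector_Spaces.linear smul smul K \<and> (\<forall>S. bounded S \<longrightarrow> compact (closure (K ` S)))"

definition escaping_set :: "('a::real_normed_vector \<Rightarrow> 'a) \<Rightarrow> 'a set" where
  "escaping_set R = {x. filterlim (\<lambda>t. norm ((R ^^ t) x)) at_top sequentially}"

text \<open>The limit inferior is taken in the extended reals, where it always exists.\<close>

definition recurrent_set :: "('a::real_normed_vector \<Rightarrow> 'a) \<Rightarrow> 'a set" where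
  "recurrent_set R = {x. liminf (\<lambda>t. ereal (norm ((R ^^ t) x - x))) = 0}"

end

theory Submission
  imports Defs
begin

text \<open>
  Mazur's construction gives a biorthogonal sequence \<open>(e n, f n)\<close> with \<open>norm (e n) = 1\<close> and
  \<open>norm (f n) \<le> 10\<close>.  Put \<open>a = f 0\<close>, \<open>b = f 1\<close> and group the other vectors into planes.
  The operator rotates the \<open>n\<close>-th plane by the angle \<open>2 * pi / period (n + 1)\<close>, where
  \<open>period n = 2 ^ n\<^sup>2\<close>, about a centre proportional to \<open>u n x = a x - r n * b x\<close>; real
  rotations serve both scalar fields.  Each \<open>period m\<close> divides \<open>period (m + 1)\<close>, so at time \<open>period n\<close> the
  planes before the \<open>n\<close>-th are back in their initial position, those after it have hardly
  moved, and the \<open>n\<close>-th has moved by about \<open>K n * norm (u n x)\<close>.  Moreover, between two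
  consecutive such times some plane has always moved at least that much.

  Here \<open>K\<close> tends to infinity, but so slowly that the points \<open>r n\<close> of the unit ball of the
  scalars can approximate each \<open>s\<close> of that ball with \<open>K n * norm (s - r n)\<close> arbitrarily small.
  If \<open>norm (a x) > norm (b x)\<close>, then \<open>norm (u n x)\<close> is bounded below and the orbit escapes;
  otherwise \<open>a x = s * b x\<close> with \<open>norm s \<le> 1\<close>, and \<open>x\<close> is recurrent.
\<close>

section \<open>The Hahn--Banach theorem\<close>

text \<open>Homogeneity is asked only as an inequality, which infima of such functionals inherit
  directly; scaling back by \<open>1 / c\<close> turns it into an equality.\<close>

definition sublinear :: "('a::real_vector \<Rightarrow> real) \<Rightarrow> bool" where
  "sublinear p \<longleftrightarrow>
     (\<forall>x y. p (x + y) \<le> p x + p y) \<and> (\<forall>c x. 0 \<le> c \<longrightarrow> p (c *\<^sub>R x) \<le> c * p x)"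

lemma sublinear_zero: "sublinear p \<Longrightarrow> p 0 = 0"
proof -
  assume p: "sublinear p"
  have "p (0 *\<^sub>R 0) \<le> 0 * p 0" "p (0 + 0) \<le> p 0 + p 0"
    using p unfolding sublinear_def by blast+
  then show ?thesis by simp
qed

lemma sublinear_minus:
  assumes "sublinear p" shows "- p (- x) \<le> p x"
proof -
  have "p (x + - x) \<le> p x + p (- x)" using assms unfolding sublinear_def by blast
  then show ?thesis using sublinear_zero[OF assms] by simp
qed

lemma sublinear_scale:
  assumes "sublinear p" "0 \<le> c" shows "p (c *\<^sub>R x) = c * p x"
proof (cases "c = 0")
  case True
  then show ?thesis using sublinear_zero[OF assms(1)] by simp
next
  case False
  have "p ((1 / c) *\<^sub>R (c *\<^sub>R x)) \<le> (1 / c) * p (c *\<^sub>R x)"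
    using assms unfolding sublinear_def by (meson divide_nonneg_nonneg zero_le_one)
  then have "c * p x \<le> p (c *\<^sub>R x)" using False assms(2) by (simp add: field_simps)
  then show ?thesis using assms unfolding sublinear_def by (simp add: order_antisym)
qed

text \<open>Take the infimum over t >= 0 of \<open>q (x + t *\<^sub>R y) - t * q y\<close>. It is
  finite because each term is at least \<open>- q (- x)\<close>; t = 0 gives
  \<open>q' \<le> q\<close>, and t = 1 at \<open>- y\<close> gives the last bound.\<close>

lemma sublinear_shrink:
  assumes q: "sublinear q"
  obtains q' where "sublinear q'" "q' \<le> q" "q' (- y) \<le> - q y"
proof -
  define f where "f x t = q (x + t *\<^sub>R y) - t * q y" for x t
  define q' where "q' x = (INF t\<in>{0..}. f x t)" for x
  have lower: "- q (- x) \<le> f x t" if "t \<ge> 0" for x t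
  proof -
    have "q (- x + (x + t *\<^sub>R y)) \<le> q (- x) + q (x + t *\<^sub>R y)"
      using q unfolding sublinear_def by blast
    then show ?thesis using sublinear_scale[OF q that, of y] by (simp add: f_def)
  qed
  then have bdd: "bdd_below (f x ` {0..})" for x
    by (intro bdd_belowI2[where m = "- q (- x)"]) auto
  have le: "q' x \<le> f x t" if "t \<ge> 0" for x t
    unfolding q'_def using that by (intro cINF_lower bdd) auto
  have ge: "m \<le> q' x" if "\<And>t. t \<ge> 0 \<Longrightarrow> m \<le> f x t" for m x
    unfolding q'_def using that by (intro cINF_greatest) auto
  have sub: "q' (u + v) \<le> q' u + q' v" for u v
  proof -
    have *: "q' (u + v) \<le> f u s + f v t" if "s \<ge> 0" "t \<ge> 0" for s t
    proof -
      have "q ((u + s *\<^sub>R y) + (v + t *\<^sub>R y)) \<le> q (u + s *\<^sub>R y) + q (v + t *\<^sub>R y)"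
        using q unfolding sublinear_def by blast
      then have "f (u + v) (s + t) \<le> f u s + f v t"
        by (simp add: f_def algebra_simps)
      then show ?thesis using le[of "s + t" "u + v"] that by simp
    qed
    have "q' (u + v) - f v t \<le> q' u" if "t \<ge> 0" for t
      using *[OF _ that] by (intro ge) (simp add: algebra_simps)
    then have "q' (u + v) - q' u \<le> q' v"
      by (intro ge) (simp add: algebra_simps)
    then show ?thesis by simp
  qed
  have pos: "q' (c *\<^sub>R x) \<le> c * q' x" if "c > 0" for c x
  proof -
    have "q' (c *\<^sub>R x) / c \<le> f x t" if "t \<ge> 0" for t
    proof -
      have "f (c *\<^sub>R x) (c * t) = c * f x t"
        using sublinear_scale[OF q, of c "x + t *\<^sub>R y"] \<open>c > 0\<close>
        by (simp add: f_def algebra_simps)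
      then show ?thesis
        using le[of "c * t" "c *\<^sub>R x"] that \<open>c > 0\<close> by (simp add: field_simps)
    qed
    then have "q' (c *\<^sub>R x) / c \<le> q' x" by (rule ge)
    then show ?thesis using that by (simp add: field_simps)
  qed
  have "q' 0 \<le> 0"
    using le[of 0 0] by (simp add: f_def sublinear_zero[OF q])
  then have "sublinear q'"
    unfolding sublinear_def using sub pos by (metis mult_zero_left order_le_less scaleR_zero_left)
  moreover have "q' \<le> q"
    using le[of 0] by (auto simp: le_fun_def f_def)
  moreover have "q' (- y) \<le> - q y"
    using le[of 1 "- y"] by (simp add: f_def sublinear_zero[OF q])
  ultimately show thesis using that by blast
qed

text \<open>The members share the lower bound \<open>- p (- x)\<close>, so the pointwise infimum is
  finite. It is subadditive because the smaller of two members of a chain can serve for both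
  summands.\<close>

lemma sublinear_INF:
  fixes C :: "('a::real_vector \<Rightarrow> real) set"
  assumes "C \<noteq> {}" "\<And>q. q \<in> C \<Longrightarrow> sublinear q \<and> q \<le> p"
    and chain: "\<And>q r. q \<in> C \<Longrightarrow> r \<in> C \<Longrightarrow> q \<le> r \<or> r \<le> q"
  obtains u where "sublinear u" "\<And>q. q \<in> C \<Longrightarrow> u \<le> q"
proof -
  define u where "u x = (INF q\<in>C. q x)" for x
  have "- p (- x) \<le> q x" if "q \<in> C" for q x
    using sublinear_minus[of q x] assms(2)[OF that] by (auto simp: le_fun_def intro: order_trans[rotated])
  then have bdd: "bdd_below ((\<lambda>q. q x) ` C)" for x
    by (intro bdd_belowI2) auto
  have le: "u x \<le> q x" if "q \<in> C" for x q
    unfolding u_def using that by (intro cINF_lower bdd) auto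
  have ge: "m \<le> u x" if "\<And>q. q \<in> C \<Longrightarrow> m \<le> q x" for m x
    unfolding u_def using that by (intro cINF_greatest assms)
  have sub: "u (x + y) \<le> u x + u y" for x y
  proof -
    have *: "u (x + y) \<le> q x + r y" if qr: "q \<in> C" "r \<in> C" for q r
    proof -
      obtain s where s: "s \<in> C" "s \<le> q" "s \<le> r" using chain[OF qr] qr by blast
      have "u (x + y) \<le> s x + s y"
        using le[OF s(1), of "x + y"] assms(2)[OF s(1)] unfolding sublinear_def
        by (meson order_trans)
      also have "\<dots> \<le> q x + r y"
        using s(2,3) by (intro add_mono) (auto simp: le_fun_def)
      finally show ?thesis .
    qed
    have "u (x + y) - r y \<le> u x" if "r \<in> C" for r
      using *[OF _ that] by (intro ge) (simp add: algebra_simps)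
    then have "u (x + y) - u x \<le> u y"
      by (intro ge) (simp add: algebra_simps)
    then show ?thesis by simp
  qed
  have scale: "u (c *\<^sub>R x) \<le> c * u x" if "c \<ge> 0" for c x
  proof (cases "c = 0")
    case True
    obtain q where "q \<in> C" using assms(1) by blast
    then show ?thesis using True le[of q 0] sublinear_zero assms(2) by fastforce
  next
    case False
    then have "c > 0" using that by simp
    have "u (c *\<^sub>R x) / c \<le> q x" if "q \<in> C" for q
      using le[OF that, of "c *\<^sub>R x"] assms(2)[OF that] sublinear_scale[of q c x] \<open>c > 0\<close>
      by (simp add: field_simps)
    then have "u (c *\<^sub>R x) / c \<le> u x" by (rule ge)
    then show ?thesis using \<open>c > 0\<close> by (simp add: field_simps)
  qed
  have "sublinear u" unfolding sublinear_def using sub scale by blast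
  moreover have "u \<le> q" if "q \<in> C" for q
    using le[OF that] by (simp add: le_fun_def)
  ultimately show thesis using that by blast
qed

text \<open>Zorn's lemma for the reversed pointwise order: infima bound nonempty chains, and
  \<open>p\<close> bounds the empty one.\<close>

lemma sublinear_minimal:
  assumes p: "sublinear p"
  obtains q where "sublinear q" "q \<le> p" "\<And>r. sublinear r \<Longrightarrow> r \<le> q \<Longrightarrow> r = q"
proof -
  define A where "A = {q. sublinear q \<and> q \<le> p}"
  have "\<exists>m\<in>A. \<forall>a\<in>A. a \<le> m \<longrightarrow> a = m"
  proof (rule predicate_Zorn)
    show "partial_order_on A (relation_of (\<lambda>a b. b \<le> a) A)"
      by (rule partial_order_on_relation_ofI) auto
    fix C assume C: "C \<in> Chains (relation_of (\<lambda>a b. b \<le> a) A)"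
    then have CA: "C \<subseteq> A" by (auto simp: Chains_def relation_of_def)
    show "\<exists>u\<in>A. \<forall>a\<in>C. u \<le> a"
    proof (cases "C = {}")
      case True
      then show ?thesis using p by (auto simp: A_def)
    next
      case False
      obtain u where u: "sublinear u" "\<And>q. q \<in> C \<Longrightarrow> u \<le> q"
      proof (rule sublinear_INF[of C p])
        show "q \<le> r \<or> r \<le> q" if "q \<in> C" "r \<in> C" for q r
          using C that by (auto simp: Chains_def relation_of_def)
      qed (use False CA A_def in auto)
      moreover have "u \<le> p" using u(2) False CA by (force simp: A_def)
      ultimately show ?thesis by (auto simp: A_def)
    qed
  qed
  then show thesis using that by (force simp: A_def)
qed

text \<open>A minimal sublinear functional is linear, as shrinking it in a direction \<open>y\<close> has no effect.\<close>
lemma sublinear_dominates_linear: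
  assumes "sublinear p"
  obtains g where "linear g" "g \<le> p"
proof -
  obtain q where q: "sublinear q" "q \<le> p" and min: "\<And>r. sublinear r \<Longrightarrow> r \<le> q \<Longrightarrow> r = q"
    using sublinear_minimal[OF assms] by blast
  have neg: "q (- y) = - q y" for y
  proof -
    obtain r where "sublinear r" "r \<le> q" "r (- y) \<le> - q y"
      using sublinear_shrink[OF q(1)] by blast
    then show ?thesis using min sublinear_minus[OF q(1), of y] by fastforce
  qed
  have le: "q (x + y) \<le> q x + q y" for x y using q(1) by (simp add: sublinear_def)
  have "q (x + y) = q x + q y" for x y
    using le[of x y] le[of "- x" "- y"] neg[of x] neg[of y] neg[of "x + y"] by simp
  moreover have "q (c *\<^sub>R x) = c *\<^sub>R q x" for c x
  proof (cases "0 \<le> c")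
    case False
    then show ?thesis
      using sublinear_scale[OF q(1), of "- c" x] neg[of "c *\<^sub>R x"] by simp
  qed (simp add: sublinear_scale[OF q(1)])
  ultimately have "linear q" by (intro linearI)
  then show thesis using that q(2) by blast
qed

text \<open>The distance to \<open>F\<close> is sublinear, vanishes on \<open>F\<close> and is at
  least \<open>d\<close> at \<open>y\<close>. A linear functional below it, made large at
  \<open>y\<close>, is divided by its value there.\<close>

lemma hahn_banach_real:
  fixes F :: "'a::real_normed_vector set"
  assumes F: "subspace F" and "0 < d" and d: "\<And>z. z \<in> F \<Longrightarrow> d \<le> norm (y - z)"
  obtains g where "linear g" "\<And>x. \<bar>g x\<bar> \<le> norm x / d" "\<And>z. z \<in> F \<Longrightarrow> g z = 0" "g y = 1"
proof -
  have ne: "F \<noteq> {}" using subspace_0[OF F] by blast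
  define p where "p x = infdist x F" for x
  have le: "p x \<le> norm (x - z)" if "z \<in> F" for x z
    unfolding p_def using infdist_le[OF that, of x] by (simp add: dist_norm)
  have ge: "m \<le> p x" if "\<And>z. z \<in> F \<Longrightarrow> m \<le> norm (x - z)" for m x
    unfolding p_def infdist_def using ne that by (auto intro!: cINF_greatest simp: dist_norm)
  have "p (u + v) \<le> p u + p v" for u v
  proof -
    have *: "p (u + v) \<le> norm (u - s) + norm (v - t)" if "s \<in> F" "t \<in> F" for s t
      using le[of "s + t" "u + v"] subspace_add[OF F that] norm_triangle_ineq[of "u - s" "v - t"]
      by (simp add: algebra_simps)
    have "p (u + v) - norm (v - t) \<le> p u" if "t \<in> F" for t
      using *[OF _ that] by (intro ge) (simp add: algebra_simps)
    then have "p (u + v) - p u \<le> p v"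
      by (intro ge) (simp add: algebra_simps)
    then show ?thesis by simp
  qed
  moreover have "p (c *\<^sub>R x) \<le> c * p x" if "c \<ge> 0" for c x
  proof (cases "c = 0")
    case True
    then show ?thesis using le[of 0 0] subspace_0[OF F] by simp
  next
    case False
    have "p (c *\<^sub>R x) / c \<le> norm (x - z)" if "z \<in> F" for z
    proof -
      have "p (c *\<^sub>R x) \<le> norm (c *\<^sub>R (x - z))"
        using le[of "c *\<^sub>R z" "c *\<^sub>R x"] subspace_scale[OF F that] by (simp add: algebra_simps)
      also have "\<dots> = c * norm (x - z)" using \<open>c \<ge> 0\<close> by simp
      finally show ?thesis using False \<open>c \<ge> 0\<close> by (simp add: field_simps)
    qed
    then have "p (c *\<^sub>R x) / c \<le> p x" by (rule ge)
    then show ?thesis using False that by (simp add: field_simps)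
  qed
  ultimately have p: "sublinear p" by (simp add: sublinear_def)
  \<comment> \<open>Shrinking in the direction \<open>y\<close> first forces
    \<open>g (- y) \<le> - p y\<close>, hence \<open>g y \<ge> d\<close>, for every linear
    \<open>g\<close> below \<open>q\<close>.\<close>
  obtain q where q: "sublinear q" "q \<le> p" "q (- y) \<le> - p y"
    using sublinear_shrink[OF p] by blast
  obtain g where g: "linear g" "g \<le> q"
    using sublinear_dominates_linear[OF q(1)] by blast
  have gp: "g x \<le> p x" for x using g(2) q(2) by (meson le_funD order_trans)
  have neg: "g (- x) = - g x" for x using linear_neg[OF g(1)] .
  have "g (- y) \<le> - p y" using g(2) q(3) by (meson le_funD order_trans)
  then have gy: "g y \<ge> d" using neg[of y] ge[of d y] d by auto
  have bound: "\<bar>g x\<bar> \<le> norm x" for x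
    using gp[of x] gp[of "- x"] le[of 0 x] le[of 0 "- x"] subspace_0[OF F] neg[of x] by auto
  have zero: "g z = 0" if "z \<in> F" for z
    using gp[of z] gp[of "- z"] le[of z z] le[of "- z" "- z"] subspace_neg[OF F that] that neg[of z]
    by auto
  show thesis
  proof (rule that[of "\<lambda>x. g x / g y"])
    show "linear (\<lambda>x. g x / g y)"
      using g(1) by (simp add: linear_iff add_divide_distrib)
    show "\<bar>g x / g y\<bar> \<le> norm x / d" for x
      using bound[of x] gy \<open>0 < d\<close> by (auto simp: abs_divide intro!: frac_le)
  qed (use zero gy \<open>0 < d\<close> in auto)
qed

section \<open>Bounded biorthogonal sequences\<close>

text \<open>Induction, as the sum of two compact sets is compact. Values of \<open>c\<close> from
  \<open>N\<close> on are unconstrained and do not enter the sum.\<close>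

lemma compact_finite_sums:
  fixes C :: "nat \<Rightarrow> 'a::real_normed_vector set"
  assumes "\<And>i. i < N \<Longrightarrow> compact (C i)"
  shows "compact ((\<lambda>c. \<Sum>i<N. c i) ` {c. \<forall>i<N. c i \<in> C i})"
  using assms
proof (induction N)
  case 0
  then show ?case by (auto intro: finite_imp_compact)
next
  case (Suc N)
  let ?S = "\<lambda>N. (\<lambda>c. \<Sum>i<N. c i) ` {c. \<forall>i<N. c i \<in> C i}"
  have "compact {x + y |x y. x \<in> ?S N \<and> y \<in> C N}"
    using Suc by (intro compact_sums) auto
  moreover have "{x + y |x y. x \<in> ?S N \<and> y \<in> C N} = ?S (Suc N)" (is "?L = ?R")
  proof (intro equalityI subsetI)
    fix w assume "w \<in> ?L"
    then obtain a c where ac: "\<forall>i<N. a i \<in> C i" "c \<in> C N" "w = (\<Sum>i<N. a i) + c" by auto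
    let ?a = "a(N := c)"
    have "w = (\<Sum>i<Suc N. ?a i)" using ac(3) by simp
    moreover have "\<forall>i<Suc N. ?a i \<in> C i" using ac(1,2) by (simp add: less_Suc_eq)
    ultimately show "w \<in> ?R" by blast
  next
    fix w assume "w \<in> ?R"
    then show "w \<in> ?L" by (force simp: less_Suc_eq)
  qed
  ultimately show ?case by simp
qed

section \<open>Common kernels of finitely many bounded functionals\<close>

context normed_space_over
begin

text \<open>The bound is explicit because the biorthogonal functionals must be bounded uniformly in
  their index.\<close>

definition bounded_functional :: "real \<Rightarrow> ('a \<Rightarrow> 'k) \<Rightarrow> bool" where
  "bounded_functional M g \<longleftrightarrow>
     (\<forall>x y. g (x + y) = g x + g y) \<and> (\<forall>c x. g (smul c x) = c * g x) \<and>
     (\<forall>x. norm (g x) \<le> M * norm x)"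

lemma
  assumes "bounded_functional M g"
  shows bounded_functional_add: "g (x + y) = g x + g y"
    and bounded_functional_smul: "g (smul c x) = c * g x"
    and bounded_functional_norm: "norm (g x) \<le> M * norm x"
  using assms unfolding bounded_functional_def by blast+

lemma bounded_functional_bounded_linear:
  assumes "bounded_functional M g" shows "bounded_linear g"
proof
  show "g (x + y) = g x + g y" for x y
    using assms by (rule bounded_functional_add)
  show "g (r *\<^sub>R x) = r *\<^sub>R g x" for r x
    using bounded_functional_smul[OF assms, of "of_real r" x]
    by (simp add: scale_of_real scaleR_conv_of_real)
  show "\<exists>K. \<forall>x. norm (g x) \<le> norm x * K"
    using bounded_functional_norm[OF assms] by (metis mult.commute)
qed

lemma bounded_linear_smul_left: "bounded_linear (\<lambda>c. smul c x)"
proof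
  show "smul (r *\<^sub>R c) x = r *\<^sub>R smul c x" for r c
    by (metis scaleR_conv_of_real scale_of_real scale_scale)
  show "\<exists>K. \<forall>c. norm (smul c x) \<le> norm c * K" using norm_scale by force
qed (rule scale_left_distrib)

lemma bounded_linear_smul_right: "bounded_linear (smul c)"
proof
  show "smul c (r *\<^sub>R y) = r *\<^sub>R smul c y" for r y
    by (metis scale_of_real scale_scale mult.commute)
  show "\<exists>K. \<forall>y. norm (smul c y) \<le> norm y * K" using norm_scale by (metis order_refl mult.commute)
qed (rule scale_right_distrib)

text \<open>Each functional costs at most one dimension: if \<open>g\<close> does not vanish on the
  common kernel so far, a vector \<open>z0\<close> there with \<open>g z0 \<noteq> 0\<close> joins
  the complement and corrects the value of \<open>g\<close>.\<close>

lemma finite_codimension_kernels: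
  assumes "finite G" "\<And>g. g \<in> G \<Longrightarrow> \<exists>M. bounded_functional M g"
  shows "\<exists>B. finite B \<and> (\<forall>x. \<exists>z. (\<forall>g\<in>G. g z = 0) \<and> x - z \<in> span B)"
  using assms
proof (induction G rule: finite_induct)
  case empty
  have "x - x \<in> span {}" for x by simp
  then show ?case by blast
next
  case (insert g G)
  then obtain B where B: "finite B" "\<And>x. \<exists>z. (\<forall>g\<in>G. g z = 0) \<and> x - z \<in> span B"
    by blast
  have lin: "h (u - smul c v) = h u - c * h v" if "h \<in> insert g G" for h u v c
    using insert.prems[OF that] bounded_functional_smul
    by (metis bounded_functional_bounded_linear bounded_linear.linear linear_diff)
  show ?case
  proof (cases "\<forall>z. (\<forall>g\<in>G. g z = 0) \<longrightarrow> g z = 0")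
    case True
    have "\<exists>z. (\<forall>h\<in>insert g G. h z = 0) \<and> x - z \<in> span B" for x
      using B(2)[of x] True by blast
    then show ?thesis using B(1) by blast
  next
    case False
    then obtain z0 where z0: "\<forall>g\<in>G. g z0 = 0" "g z0 \<noteq> 0" by blast
    have "\<exists>z. (\<forall>h\<in>insert g G. h z = 0) \<and> x - z \<in> span (insert z0 B)" for x
    proof -
      obtain z where z: "\<forall>g\<in>G. g z = 0" "x - z \<in> span B" using B(2) by blast
      define c where "c = g z / g z0"
      have "x - z \<in> span (insert z0 B)"
        using z(2) span_mono[of B "insert z0 B"] by blast
      moreover have "smul c z0 \<in> span (insert z0 B)"
        by (intro span_scale span_base) simp
      ultimately have "(x - z) + smul c z0 \<in> span (insert z0 B)" by (rule span_add)
      moreover have "(x - z) + smul c z0 = x - (z - smul c z0)" by simp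
      moreover have "h (z - smul c z0) = 0" if "h \<in> insert g G" for h
        using lin[OF that, of z c z0] that z(1) z0 by (auto simp: c_def)
      ultimately show ?thesis by metis
    qed
    then show ?thesis using B(1) by (meson finite_insert)
  qed
qed

text \<open>Were the common kernel trivial, its finite complement would span the space, and a
  maximal independent subset of that complement would be a finite basis.\<close>

lemma infinite_dimensional_common_kernel:
  assumes "infinite_dimensional smul" "finite G" "\<And>g. g \<in> G \<Longrightarrow> \<exists>M. bounded_functional M g"
  obtains y where "y \<noteq> 0" "\<And>g. g \<in> G \<Longrightarrow> g y = 0"
proof (rule ccontr)
  assume contra: "\<not> thesis"
  obtain B where B: "finite B" "\<And>x. \<exists>z. (\<forall>g\<in>G. g z = 0) \<and> x - z \<in> span B"
    using finite_codimension_kernels[OF assms(2,3)] by blast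
  have all: "x \<in> span B" for x
    using B(2)[of x] contra that by (metis diff_zero)
  obtain B' where B': "B' \<subseteq> B" "independent B'" "B \<subseteq> span B'"
    using maximal_independent_subset[of B] by blast
  have "span B' = UNIV"
    using all span_minimal[OF B'(3) subspace_span] by blast
  then have "finite_dimensional_vector_space smul B'"
    using B'(1,2) B(1) finite_subset by unfold_locales auto
  then show False using assms(1) by (auto simp: infinite_dimensional_def)
qed

end

text \<open>Interface shared by real and complex scalars. The constant 2 leaves room for bounding a
  complex functional by its real and imaginary parts; \<open>heine_borel\<close> makes closed balls
  of scalars compact.\<close>

locale normed_space_hahn_banach = normed_space_over smul
  for smul :: "'k::{real_normed_field,heine_borel} \<Rightarrow> 'a::banach \<Rightarrow> 'a" +
  assumes hahn_banach:
    "\<lbrakk>subspace F; 0 < d; \<And>z. z \<in> F \<Longrightarrow> d \<le> norm (y - z)\<rbrakk> \<Longrightarrow>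
       \<exists>g. bounded_functional (2 / d) g \<and> (\<forall>z\<in>F. g z = 0) \<and> g y = 1"
begin

text \<open>Separate \<open>c\<close> from the zero subspace and rescale by \<open>norm c\<close>;
  the bound \<open>2 / norm c\<close> becomes 2.\<close>

lemma norming_functional:
  obtains h where "bounded_functional 2 h" "norm (h c) = norm c"
proof (cases "c = 0")
  case True
  show thesis by (rule that[of "\<lambda>_. 0"]) (auto simp: True bounded_functional_def)
next
  case False
  then obtain g where g: "bounded_functional (2 / norm c) g" "g c = 1"
    using hahn_banach[of "{0}" "norm c" c] subspace_single_0 by auto
  let ?h = "\<lambda>x. of_real (norm c) * g x"
  have "bounded_functional 2 ?h"
    using g(1) False unfolding bounded_functional_def
    by (auto simp: algebra_simps norm_mult divide_simps)
  then show thesis by (rule that) (simp add: g norm_mult)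
qed

text \<open>Mazur's construction: the functionals norming a net of the unit sphere of the span cut out
  a subspace of finite codimension that is uniformly transversal to the span.\<close>
lemma extend_biorthogonal:
  fixes e :: "nat \<Rightarrow> 'a" and f :: "nat \<Rightarrow> 'a \<Rightarrow> 'k"
  assumes inf: "infinite_dimensional smul"
    and f: "\<And>i. i < n \<Longrightarrow> bounded_functional 10 (f i)"
    and fe: "\<And>i j. i < n \<Longrightarrow> j < n \<Longrightarrow> f i (e j) = (if i = j then 1 else 0)"
  obtains y g where "norm y = 1" "bounded_functional 10 g" "g y = 1"
    "\<And>i. i < n \<Longrightarrow> f i y = 0" "\<And>i. i < n \<Longrightarrow> g (e i) = 0"
proof -
  define comb where "comb a = (\<Sum>i<n. smul (a i) (e i))" for a
  define F where "F = range comb"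
  have coord: "f i (comb a) = a i" if "i < n" for i a
  proof -
    have "f i (comb a) = (\<Sum>j<n. a j * f i (e j))"
      using f[OF that] unfolding comb_def
      by (simp add: bounded_functional_smul linear_sum bounded_linear.linear
          bounded_functional_bounded_linear)
    also have "\<dots> = (\<Sum>j<n. if j = i then a j else 0)"
      using fe[OF that] by (intro sum.cong) auto
    also have "\<dots> = a i" using that by simp
    finally show ?thesis .
  qed
  have F: "subspace F"
  proof (rule subspaceI)
    have "comb (\<lambda>_. 0) = 0" by (simp add: comb_def)
    then show "0 \<in> F" unfolding F_def by (metis rangeI)
    show "x + y \<in> F" if xy: "x \<in> F" "y \<in> F" for x y
    proof -
      obtain a b where "x = comb a" "y = comb b" using xy by (auto simp: F_def)
      then have "x + y = comb (\<lambda>i. a i + b i)"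
        by (simp add: comb_def scale_left_distrib sum.distrib)
      then show ?thesis by (simp add: F_def)
    qed
    show "smul c x \<in> F" if x: "x \<in> F" for c x
    proof -
      obtain a where "x = comb a" using x by (auto simp: F_def)
      then have "smul c x = comb (\<lambda>i. c * a i)"
        by (simp add: comb_def scale_sum_right)
      then show ?thesis by (simp add: F_def)
    qed
  qed
  have eF: "e i \<in> F" if "i < n" for i
  proof -
    have "comb (\<lambda>j. if j = i then 1 else 0) = e i"
      using that by (simp add: comb_def if_distrib[of "\<lambda>c. smul c _"] cong: if_cong)
    then show ?thesis unfolding F_def by (metis rangeI)
  qed
  have scaleF: "r *\<^sub>R z \<in> F" if "z \<in> F" for r z
    using subspace_scale[OF F that, of "of_real r"] by (simp add: scale_of_real)
  \<comment> \<open>The coordinate functionals are bounded by 10, so this compact set of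
    combinations contains the unit sphere of \<open>F\<close> and supplies a finite net for
    it.\<close>
  define D where "D = (\<lambda>v. \<Sum>i<n. v i) ` {v. \<forall>i<n. v i \<in> (\<lambda>c. smul c (e i)) ` cball 0 10}"
  have "compact D"
    unfolding D_def
    by (intro compact_finite_sums compact_continuous_image linear_continuous_on
        bounded_linear_smul_left compact_cball)
  then obtain N where N: "finite N" "D \<subseteq> (\<Union>c\<in>N. ball c (1/6))"
    unfolding compact_eq_totally_bounded by (meson divide_pos_pos zero_less_numeral zero_less_one)
  have "\<exists>h. bounded_functional 2 h \<and> norm (h c) = norm c" for c
    using norming_functional[of c] by blast
  then obtain h where h: "\<And>c. bounded_functional 2 (h c)" "\<And>c. norm (h c c) = norm c"
    using choice[of "\<lambda>c h. bounded_functional 2 h \<and> norm (h c) = norm c"] by blast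
  obtain y where y: "y \<noteq> 0" "\<And>g. g \<in> f ` {..<n} \<union> h ` N \<Longrightarrow> g y = 0"
    using infinite_dimensional_common_kernel[of "f ` {..<n} \<union> h ` N"] inf f h N(1) by blast
  \<comment> \<open>If \<open>c\<close> is within 1/6 of \<open>z\<close>, then
    \<open>norm c\<close> exceeds 5/6 and \<open>norm (h c z)\<close> is at least 5/6 - 2/6 = 1/2.
    Adding multiples of \<open>y\<close> does not change the value of \<open>h c\<close>, whose
    bound 2 yields 1/4.\<close>
  have unit: "1/4 \<le> norm (z + r *\<^sub>R y)" if z: "z \<in> F" "norm z = 1" for z r
  proof -
    obtain a where a: "z = comb a" using z by (auto simp: F_def)
    have "norm (a i) \<le> 10" if "i < n" for i
      using bounded_functional_norm[OF f[OF that], of z] z coord[OF that, of a] a by simp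
    then have "z \<in> D" by (force simp: D_def a comb_def)
    then have "z \<in> (\<Union>c\<in>N. ball c (1/6))" using N(2) by blast
    then obtain c where c: "c \<in> N" "norm (c - z) < 1/6" by (auto simp: dist_norm)
    interpret h: bounded_linear "h c" using bounded_functional_bounded_linear[OF h(1)] .
    have "norm (h c (c - z)) \<le> 2 * norm (c - z)" using bounded_functional_norm[OF h(1)] .
    moreover have "norm c \<ge> norm z - norm (c - z)"
      by (metis norm_minus_commute norm_triangle_ineq2 diff_le_eq add.commute norm_triangle_sub)
    moreover have "norm (h c c) - norm (h c z) \<le> norm (h c (c - z))"
      unfolding h.diff by (rule norm_triangle_ineq2)
    ultimately have "norm (h c z) \<ge> 1/2" using c(2) z(2) h(2)[of c] by linarith
    moreover have "h c (z + r *\<^sub>R y) = h c z"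
      using y(2)[of "h c"] c(1) by (simp add: h.add h.scaleR)
    ultimately show ?thesis
      using bounded_functional_norm[OF h(1)[of c], of "z + r *\<^sub>R y"] by simp
  qed
  define u where "u = (1 / norm y) *\<^sub>R y"
  have u: "norm u = 1" using y(1) by (simp add: u_def)
  \<comment> \<open>Rescaling \<open>unit\<close> gives
    \<open>norm z \<le> 4 * norm (u - z)\<close>; with \<open>norm u = 1\<close> this yields 1/5,
    and so the bound 2 / (1/5) = 10 for \<open>g\<close>, whatever \<open>n\<close> is.\<close>
  have "1/5 \<le> norm (u - z)" if "z \<in> F" for z
  proof (cases "z = 0")
    case False
    have "1/4 \<le> norm ((- 1 / norm z) *\<^sub>R z + (1 / norm z / norm y) *\<^sub>R y)"
      using False that by (intro unit scaleF) auto
    also have "(- 1 / norm z) *\<^sub>R z + (1 / norm z / norm y) *\<^sub>R y = (1 / norm z) *\<^sub>R (u - z)"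
      by (simp add: u_def scaleR_diff_right)
    finally have "1/4 \<le> norm (u - z) / norm z" by (simp only: norm_scaleR) simp
    then have "norm z \<le> 4 * norm (u - z)" using False by (simp add: field_simps)
    then show ?thesis using u norm_triangle_sub[of u z] by simp
  qed (simp add: u)
  then obtain g where g: "bounded_functional (2 / (1/5)) g" "\<forall>z\<in>F. g z = 0" "g u = 1"
    using hahn_banach[OF F, of "1/5" u] by auto
  have "f i u = 0" if "i < n" for i
    using bounded_functional_smul[OF f[OF that], of "of_real (1 / norm y)" y] y(2)[of "f i"] that
    by (simp add: u_def scale_of_real[symmetric])
  then show thesis using that[of u g] u g eF by simp
qed

theorem bounded_biorthogonal_sequence:
  assumes inf: "infinite_dimensional smul"
  obtains e :: "nat \<Rightarrow> 'a" and f :: "nat \<Rightarrow> 'a \<Rightarrow> 'k"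
  where "\<And>n. norm (e n) = 1" "\<And>n. bounded_functional 10 (f n)"
    "\<And>m n. f m (e n) = (if m = n then 1 else 0)"
proof -
  \<comment> \<open>A new pair is biorthogonal to the earlier ones in both directions, so the full
    relation follows by comparing indices.\<close>
  define P where "P s n p \<longleftrightarrow> norm (fst p) = 1 \<and> bounded_functional 10 (snd p) \<and> snd p (fst p) = 1 \<and>
    (\<forall>i<n. snd (s i) (fst p) = 0 \<and> snd p (fst (s i)) = 0)"
    for s :: "nat \<Rightarrow> 'a \<times> ('a \<Rightarrow> 'k)" and n p
  have "\<exists>s. \<forall>n. P s n (s n)"
  proof (rule dependent_wellorder_choice)
    show "P s n r = P t n r" if "\<And>i. i < n \<Longrightarrow> s i = t i" for r s t and n :: nat
      using that by (simp add: P_def)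
    show "\<exists>r. P s n r" if s: "\<And>i. i < n \<Longrightarrow> P s i (s i)" for n s
    proof -
      obtain y g where "norm y = 1" "bounded_functional 10 g" "g y = 1"
        "\<And>i. i < n \<Longrightarrow> snd (s i) y = 0" "\<And>i. i < n \<Longrightarrow> g (fst (s i)) = 0"
      proof (rule extend_biorthogonal[OF inf, of n "\<lambda>i. snd (s i)" "\<lambda>i. fst (s i)"])
        show "snd (s i) (fst (s j)) = (if i = j then 1 else 0)" if "i < n" "j < n" for i j
          using s[OF that(1)] s[OF that(2)] unfolding P_def by (metis linorder_neqE_nat)
      qed (use s P_def in auto)
      then have "P s n (y, g)" by (simp add: P_def)
      then show ?thesis ..
    qed
  qed
  then obtain s where s: "\<And>n. P s n (s n)" by blast
  have "snd (s m) (fst (s n)) = (if m = n then 1 else 0)" for m n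
    using s[of m] s[of n] unfolding P_def by (metis linorder_neqE_nat)
  then show thesis using that[of "\<lambda>n. fst (s n)" "\<lambda>n. snd (s n)"] s by (simp add: P_def)
qed

end

section \<open>The Hahn-Banach property for real and complex scalars\<close>

lemma normed_space_hahn_banach_real:
  "normed_space_hahn_banach (scaleR :: real \<Rightarrow> 'a::banach \<Rightarrow> 'a)"
proof -
  interpret normed_space_over "scaleR :: real \<Rightarrow> 'a \<Rightarrow> 'a"
    by unfold_locales (auto simp: scaleR_left_distrib scaleR_right_distrib)
  show ?thesis
  proof
    fix F :: "'a set" and d y
    assume "module.subspace (*\<^sub>R) F" "0 < d" "\<And>z. z \<in> F \<Longrightarrow> d \<le> norm (y - z)"
    then obtain g where g: "linear g" "\<And>x. \<bar>g x\<bar> \<le> norm x / d" "\<And>z. z \<in> F \<Longrightarrow> g z = 0" "g y = 1"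
      using hahn_banach_real by (metis subspace_raw_def)
    have "norm (g x) \<le> 2 / d * norm x" for x
    proof -
      have "norm x / d \<le> 2 * (norm x / d)" using \<open>0 < d\<close> by (simp add: divide_right_mono)
      then show ?thesis using g(2)[of x] by simp
    qed
    then have "bounded_functional (2 / d) g"
      using g(1) by (simp add: bounded_functional_def linear_add linear_scale)
    then show "\<exists>g. bounded_functional (2 / d) g \<and> (\<forall>z\<in>F. g z = 0) \<and> g y = 1" using g by blast
  qed
qed

text \<open>A real-linear \<open>g\<close> becomes complex-linear as
  \<open>g x - i * g (i x)\<close>. For the value at \<open>y\<close> to be 1, \<open>g\<close> must
  also vanish at \<open>i y\<close>, so the real line through \<open>i y\<close> is adjoined to
  \<open>F\<close>.\<close>

lemma normed_space_hahn_banach_complex: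
  fixes cscale :: "complex \<Rightarrow> 'a::banach \<Rightarrow> 'a"
  assumes "normed_space_over cscale"
  shows "normed_space_hahn_banach cscale"
proof -
  interpret normed_space_over cscale by fact
  show ?thesis
  proof
    fix F :: "'a set" and d y
    assume F: "subspace F" and d: "0 < d" "\<And>z. z \<in> F \<Longrightarrow> d \<le> norm (y - z)"
    interpret I: bounded_linear "cscale \<i>" by (rule bounded_linear_smul_right)
    define F' where "F' = {z + r *\<^sub>R cscale \<i> y | z r. z \<in> F}"
    have scaleF: "r *\<^sub>R z \<in> F" if "z \<in> F" for r z
      using subspace_scale[OF F that, of "of_real r"] by (simp add: scale_of_real)
    have F': "real_vector.subspace F'"
      unfolding real_vector.subspace_def
    proof (intro conjI ballI allI)
      have "0 = 0 + 0 *\<^sub>R cscale \<i> y" by simp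
      then show "0 \<in> F'" using subspace_0[OF F] unfolding F'_def by blast
      show "u + v \<in> F'" if "u \<in> F'" "v \<in> F'" for u v
      proof -
        obtain z r z' r' where *: "z \<in> F" "z' \<in> F" "u = z + r *\<^sub>R cscale \<i> y" "v = z' + r' *\<^sub>R cscale \<i> y"
          using \<open>u \<in> F'\<close> \<open>v \<in> F'\<close> by (auto simp: F'_def)
        have "u + v = (z + z') + (r + r') *\<^sub>R cscale \<i> y" using * by (simp add: algebra_simps)
        then show ?thesis using subspace_add[OF F *(1,2)] unfolding F'_def by blast
      qed
      show "c *\<^sub>R u \<in> F'" if "u \<in> F'" for c u
      proof -
        obtain z r where *: "z \<in> F" "u = z + r *\<^sub>R cscale \<i> y"
          using \<open>u \<in> F'\<close> by (auto simp: F'_def)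
        have "c *\<^sub>R u = c *\<^sub>R z + (c * r) *\<^sub>R cscale \<i> y" using * by (simp add: algebra_simps)
        then show ?thesis using scaleF[OF *(1)] unfolding F'_def by blast
      qed
    qed
    have "d \<le> norm (y - w)" if w: "w \<in> F'" for w
    proof -
      obtain z r where z: "z \<in> F" "w = z + r *\<^sub>R cscale \<i> y" using w by (auto simp: F'_def)
      \<comment> \<open>Factoring \<open>c\<close> out of \<open>y - w\<close> leaves
        \<open>y\<close> minus an element of \<open>F\<close>; as \<open>norm c \<ge> 1\<close>,
        adjoining the line preserves the lower bound \<open>d\<close>.\<close>
      define c where "c = 1 - complex_of_real r * \<i>"
      have "Re c = 1" by (simp add: c_def)
      then have c: "c \<noteq> 0" "1 \<le> norm c" using abs_Re_le_cmod[of c] by auto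
      have "r *\<^sub>R cscale \<i> y = cscale (of_real r * \<i>) y"
        by (metis scale_of_real scale_scale)
      then have "y - w = cscale c (y - cscale (1 / c) z)"
        using c by (simp add: z c_def scale_right_diff_distrib scale_left_diff_distrib)
      then have "norm (y - w) = norm c * norm (y - cscale (1 / c) z)" by (simp add: norm_scale)
      moreover have "d \<le> norm (y - cscale (1 / c) z)" by (intro d subspace_scale F z)
      ultimately show ?thesis using c(2)
        by (metis mult_mono' mult_1 less_imp_le \<open>0 < d\<close> zero_le_one)
    qed
    then obtain g where g: "linear g" "\<And>x. \<bar>g x\<bar> \<le> norm x / d" "\<And>z. z \<in> F' \<Longrightarrow> g z = 0" "g y = 1"
      using hahn_banach_real[OF F' d(1)] by metis
    have zero: "g z = 0" if "z \<in> F" for z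
    proof -
      have "z = z + 0 *\<^sub>R cscale \<i> y" by simp
      then show ?thesis using g(3) that unfolding F'_def by blast
    qed
    have "cscale \<i> y = 0 + 1 *\<^sub>R cscale \<i> y" by simp
    then have iy: "g (cscale \<i> y) = 0" using g(3) subspace_0[OF F] unfolding F'_def by blast
    define G where "G x = Complex (g x) (- g (cscale \<i> x))" for x
    have ii: "cscale \<i> (cscale \<i> x) = - x" for x by simp
    have "bounded_functional (2 / d) G"
      unfolding bounded_functional_def
    proof (intro conjI allI)
      show "G (u + v) = G u + G v" for u v
        by (simp add: G_def I.add linear_add[OF g(1)] complex_eq_iff)
      show "G (cscale c x) = c * G x" for c x
      proof -
        have c: "cscale c x = Re c *\<^sub>R x + Im c *\<^sub>R cscale \<i> x"
        proof -
          have "c = of_real (Re c) + of_real (Im c) * \<i>" by (simp add: complex_eq_iff)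
          then have "cscale c x = cscale (of_real (Re c)) x + cscale (of_real (Im c) * \<i>) x"
            using scale_left_distrib by metis
          then show ?thesis by (simp only: scale_scale[symmetric] scale_of_real)
        qed
        have "g (cscale c x) = Re c * g x + Im c * g (cscale \<i> x)"
          unfolding c by (simp only: linear_add[OF g(1)] linear_scale[OF g(1)] real_scaleR_def)
        moreover have "g (cscale \<i> (cscale c x)) = Re c * g (cscale \<i> x) - Im c * g x"
          unfolding c I.add I.scaleR ii
          by (simp add: linear_add[OF g(1)] linear_diff[OF g(1)] linear_scale[OF g(1)] linear_neg[OF g(1)])
        ultimately show ?thesis by (simp add: G_def complex_eq_iff)
      qed
      show "norm (G x) \<le> 2 / d * norm x" for x
        using cmod_le[of "G x"] g(2)[of x] g(2)[of "cscale \<i> x"] by (simp add: G_def norm_scale)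
    qed
    moreover have "G z = 0" if "z \<in> F" for z
      using zero[OF that] zero[OF subspace_scale[OF F that]] by (simp add: G_def complex_eq_iff)
    moreover have "G y = 1" by (simp add: G_def g iy complex_eq_iff)
    ultimately show "\<exists>g. bounded_functional (2 / d) g \<and> (\<forall>z\<in>F. g z = 0) \<and> g y = 1" by blast
  qed
qed

section \<open>Rotations in infinitely many planes\<close>

text \<open>Total boundedness: up to a tail that is small uniformly on \<open>S\<close>, the series
  is a finite sum lying in a compact set.\<close>

lemma compact_closure_suminf_image:
  fixes U :: "nat \<Rightarrow> 'b \<Rightarrow> 'a::banach"
  assumes s: "summable s" and U: "\<And>n x. x \<in> S \<Longrightarrow> norm (U n x) \<le> s n"
    and C: "\<And>n. compact (C n)" "\<And>n x. x \<in> S \<Longrightarrow> U n x \<in> C n"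
  shows "compact (closure ((\<lambda>x. \<Sum>n. U n x) ` S))" (is "compact (closure ?T)")
  unfolding compact_eq_totally_bounded
proof (intro conjI allI impI)
  show "complete (closure ?T)" by (simp add: complete_eq_closed)
  fix \<epsilon> :: real assume "\<epsilon> > 0"
  then obtain N where N: "norm (\<Sum>n. s (n + N)) < \<epsilon>/4"
    using suminf_exist_split[of "\<epsilon>/4" s] s by auto
  let ?D = "(\<lambda>c. \<Sum>i<N. c i) ` {c. \<forall>i<N. c i \<in> C i}"
  have "compact ?D" using C(1) by (rule compact_finite_sums)
  then obtain k where k: "finite k" "?D \<subseteq> (\<Union>c\<in>k. ball c (\<epsilon>/4))"
    using \<open>\<epsilon> > 0\<close> unfolding compact_eq_totally_bounded by (meson divide_pos_pos zero_less_numeral)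
  \<comment> \<open>Net error and tail error are each below \<epsilon>/4. Closed balls let the
    covering pass to the closure.\<close>
  have "?T \<subseteq> (\<Union>c\<in>k. cball c (\<epsilon>/2))"
  proof
    fix w assume "w \<in> ?T"
    then obtain x where x: "x \<in> S" "w = (\<Sum>n. U n x)" by blast
    have sU: "summable (\<lambda>n. U n x)"
      using summable_comparison_test'[OF s, of 0 "\<lambda>n. U n x"] U[OF x(1)] by simp
    have "(\<Sum>i<N. U i x) \<in> ?D" using C(2)[OF x(1)] by blast
    then obtain c where c: "c \<in> k" "dist c (\<Sum>i<N. U i x) < \<epsilon>/4" using k(2) by auto
    have "norm (\<Sum>n. U (n + N) x) \<le> (\<Sum>n. s (n + N))"
      by (rule norm_suminf_le) (use U[OF x(1)] s in auto)
    then have "norm (\<Sum>n. U (n + N) x) < \<epsilon>/4" using N by simp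
    moreover have "w - (\<Sum>i<N. U i x) = (\<Sum>n. U (n + N) x)"
      using suminf_split_initial_segment[OF sU, of N] x(2) by simp
    ultimately have "dist (\<Sum>i<N. U i x) w < \<epsilon>/4" by (simp add: dist_norm norm_minus_commute)
    then have "dist c w < \<epsilon>/2" using c(2) dist_triangle[of c w "\<Sum>i<N. U i x"] by linarith
    then show "w \<in> (\<Union>c\<in>k. cball c (\<epsilon>/2))" using c(1) by force
  qed
  then have "closure ?T \<subseteq> (\<Union>c\<in>k. cball c (\<epsilon>/2))"
    using k(1) by (intro closure_minimal closed_UN) auto
  also have "\<dots> \<subseteq> (\<Union>c\<in>k. ball c \<epsilon>)" using \<open>\<epsilon> > 0\<close> by force
  finally show "\<exists>k. finite k \<and> closure ?T \<subseteq> (\<Union>c\<in>k. ball c \<epsilon>)" using k(1) by blast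
qed

lemma abs_cos_minus_1_le: "\<bar>cos y - 1\<bar> \<le> \<bar>y :: real\<bar>"
proof -
  have "\<bar>cos y - 1\<bar> = 2 * (\<bar>sin (y/2)\<bar> * \<bar>sin (y/2)\<bar>)"
    using cos_double_sin[of "y/2"] by (simp add: power2_eq_square abs_mult)
  also have "\<dots> \<le> 2 * (\<bar>y/2\<bar> * 1)"
    by (intro mult_left_mono mult_mono abs_sin_x_le_abs_x) auto
  finally show ?thesis by simp
qed

text \<open>The bounds \<open>P n\<close> may grow, to allow centres far from the origin;
  summability of angle times bound makes the displacement a norm-convergent series of finite-rank
  maps.\<close>

locale rotation_system = normed_space_hahn_banach smul
  for smul :: "'k::{real_normed_field,heine_borel} \<Rightarrow> 'a::banach \<Rightarrow> 'a" +
  fixes E E' :: "nat \<Rightarrow> 'a" and \<Phi> \<Psi> :: "nat \<Rightarrow> 'a \<Rightarrow> 'k" and P \<theta> :: "nat \<Rightarrow> real"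
  assumes norm_E: "norm (E n) = 1" "norm (E' n) = 1"
    and functionals: "bounded_functional (P n) (\<Phi> n)" "bounded_functional (P n) (\<Psi> n)"
    and biorthogonal: "\<Phi> m (E n) = (if m = n then 1 else 0)" "\<Phi> m (E' n) = 0"
      "\<Psi> m (E n) = 0" "\<Psi> m (E' n) = (if m = n then 1 else 0)"
    and summable_angles: "summable (\<lambda>n. \<bar>\<theta> n\<bar> * P n)"
begin

sublocale \<Phi>: bounded_linear "\<Phi> n" for n
  by (rule bounded_functional_bounded_linear[OF functionals(1)])

sublocale \<Psi>: bounded_linear "\<Psi> n" for n
  by (rule bounded_functional_bounded_linear[OF functionals(2)])

text \<open>Rotation by \<open>t * \<theta> n\<close> minus the identity, in the coordinates
  \<open>\<Phi> n\<close> and \<open>\<Psi> n\<close>. Summing only these differences gives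
  convergence on the whole space without the vectors forming a basis.\<close>

definition block :: "nat \<Rightarrow> nat \<Rightarrow> 'a \<Rightarrow> 'a" where
  "block t n x =
     smul (of_real (cos (t * \<theta> n) - 1) * \<Phi> n x - of_real (sin (t * \<theta> n)) * \<Psi> n x) (E n) +
     smul (of_real (sin (t * \<theta> n)) * \<Phi> n x + of_real (cos (t * \<theta> n) - 1) * \<Psi> n x) (E' n)"

definition displacement :: "nat \<Rightarrow> 'a \<Rightarrow> 'a" where
  "displacement t x = (\<Sum>n. block t n x)"

lemma norm_block:
  "norm (block t n x) \<le> 2 * real t * \<bar>\<theta> n\<bar> * (norm (\<Phi> n x) + norm (\<Psi> n x))"
proof -
  let ?y = "real t * \<theta> n"
  have c: "norm (of_real (cos ?y - 1) * z :: 'k) \<le> \<bar>?y\<bar> * norm z" for z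
    using abs_cos_minus_1_le[of ?y] by (simp add: norm_mult mult_right_mono del: of_real_diff)
  have s: "norm (of_real (sin ?y) * z :: 'k) \<le> \<bar>?y\<bar> * norm z" for z
    using abs_sin_x_le_abs_x[of ?y] by (simp add: norm_mult mult_right_mono)
  have "norm (block t n x) \<le>
      norm (of_real (cos ?y - 1) * \<Phi> n x - of_real (sin ?y) * \<Psi> n x) +
      norm (of_real (sin ?y) * \<Phi> n x + of_real (cos ?y - 1) * \<Psi> n x)"
    unfolding block_def by (rule order_trans[OF norm_triangle_ineq]) (simp add: norm_scale norm_E)
  also have "\<dots> \<le> (norm (of_real (cos ?y - 1) * \<Phi> n x) + norm (of_real (sin ?y) * \<Psi> n x)) +
      (norm (of_real (sin ?y) * \<Phi> n x) + norm (of_real (cos ?y - 1) * \<Psi> n x))"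
    by (intro add_mono norm_triangle_ineq norm_triangle_ineq4)
  also have "\<dots> \<le> (\<bar>?y\<bar> * norm (\<Phi> n x) + \<bar>?y\<bar> * norm (\<Psi> n x)) +
      (\<bar>?y\<bar> * norm (\<Phi> n x) + \<bar>?y\<bar> * norm (\<Psi> n x))"
    by (intro add_mono c s)
  also have "\<dots> = 2 * real t * \<bar>\<theta> n\<bar> * (norm (\<Phi> n x) + norm (\<Psi> n x))"
    by (simp add: abs_mult algebra_simps)
  finally show ?thesis .
qed

lemma norm_block': "norm (block t n x) \<le> (4 * real t * norm x) * (\<bar>\<theta> n\<bar> * P n)"
proof -
  have "norm (block t n x) \<le> 2 * real t * \<bar>\<theta> n\<bar> * (P n * norm x + P n * norm x)"
    by (rule order_trans[OF norm_block])
      (intro mult_left_mono add_mono bounded_functional_norm functionals, simp)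
  then show ?thesis by (simp add: algebra_simps)
qed

lemma summable_norm_block: "summable (\<lambda>n. norm (block t n x))"
  by (rule summable_comparison_test'[OF summable_mult[OF summable_angles, of "4 * real t * norm x"], of 0])
    (simp only: real_norm_def abs_norm_cancel norm_block')

lemmas summable_block = summable_norm_cancel[OF summable_norm_block]

lemma block_add: "block t n (x + y) = block t n x + block t n y"
  by (simp add: block_def \<Phi>.add \<Psi>.add algebra_simps flip: scale_left_distrib)

lemma block_smul: "block t n (smul c x) = smul c (block t n x)"
  by (simp add: block_def bounded_functional_smul[OF functionals(1)]
      bounded_functional_smul[OF functionals(2)] scale_right_distrib algebra_simps)

lemma linear_displacement: "Vector_Spaces.linear smul smul (displacement t)"
proof
  show "displacement t (x + y) = displacement t x + displacement t y" for x y
    unfolding displacement_def block_add by (rule suminf_add[OF summable_block summable_block, symmetric])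
  show "displacement t (smul c x) = smul c (displacement t x)" for c x
    unfolding displacement_def block_smul
    by (rule bounded_linear.suminf[OF bounded_linear_smul_right summable_block, symmetric])
qed

lemma norm_displacement:
  "norm (displacement t x) \<le> norm x * (4 * real t * (\<Sum>n. \<bar>\<theta> n\<bar> * P n))"
proof -
  have "norm (displacement t x) \<le> (\<Sum>n. (4 * real t * norm x) * (\<bar>\<theta> n\<bar> * P n))"
    unfolding displacement_def
    by (intro norm_suminf_le norm_block' summable_mult summable_angles)
  also have "\<dots> = (4 * real t * norm x) * (\<Sum>n. \<bar>\<theta> n\<bar> * P n)"
    by (rule suminf_mult[OF summable_angles])
  finally show ?thesis by (simp add: mult_ac)
qed

lemma bounded_linear_displacement: "bounded_linear (displacement t)"
proof
  interpret L: Vector_Spaces.linear smul smul "displacement t" by (rule linear_displacement)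
  show "displacement t (x + y) = displacement t x + displacement t y" for x y by (rule L.add)
  show "displacement t (r *\<^sub>R x) = r *\<^sub>R displacement t x" for r x
    using L.scale[of "of_real r" x] by (simp add: scale_of_real)
  show "\<exists>K. \<forall>x. norm (displacement t x) \<le> norm x * K" using norm_displacement by blast
qed

text \<open>Each block maps a bounded set into a compact subset of a plane, with a summable bound
  over the blocks. The factor 3 adds 2 for the cosine minus 1 and 1 for the sine.\<close>

lemma compact_operator_displacement: "compact_operator smul (displacement t)"
  unfolding compact_operator_def
proof (intro conjI linear_displacement allI impI)
  fix S :: "'a set" assume "bounded S"
  then obtain r where r: "\<And>x. x \<in> S \<Longrightarrow> norm x \<le> r" unfolding bounded_iff by blast
  let ?D = "\<lambda>n. cball (0::'k) (3 * (P n * r))"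
  let ?C = "\<lambda>n. {u + v | u v. u \<in> (\<lambda>c. smul c (E n)) ` ?D n \<and> v \<in> (\<lambda>c. smul c (E' n)) ` ?D n}"
  show "compact (closure (displacement t ` S))"
    unfolding displacement_def
  proof (rule compact_closure_suminf_image)
    show "summable (\<lambda>n. (4 * real t * r) * (\<bar>\<theta> n\<bar> * P n))"
      by (intro summable_mult summable_angles)
    have P: "0 \<le> P n" for n
      using bounded_functional_norm[OF functionals(1), of n "E n"] norm_ge_zero[of "\<Phi> n (E n)"]
      unfolding norm_E by linarith
    show "norm (block t n x) \<le> (4 * real t * r) * (\<bar>\<theta> n\<bar> * P n)" if "x \<in> S" for n x
      by (rule order_trans[OF norm_block']) (use r[OF that] P in \<open>auto intro!: mult_right_mono mult_left_mono\<close>)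
    show "compact (?C n)" for n
      by (intro compact_sums compact_continuous_image linear_continuous_on bounded_linear_smul_left
          compact_cball)
    show "block t n x \<in> ?C n" if "x \<in> S" for n x
    proof -
      let ?y = "real t * \<theta> n"
      have *: "norm (\<Phi> n x) \<le> P n * r" "norm (\<Psi> n x) \<le> P n * r"
        using bounded_functional_norm[OF functionals(1), of n x]
          bounded_functional_norm[OF functionals(2), of n x] mult_left_mono[OF r[OF that] P[of n]]
        by linarith+
      have c: "norm (of_real (cos ?y - 1) * z :: 'k) \<le> 2 * norm z" for z
        using cos_ge_minus_one[of ?y] cos_le_one[of ?y]
        unfolding norm_mult norm_of_real by (intro mult_right_mono) auto
      have s: "norm (of_real (sin ?y) * z :: 'k) \<le> 1 * norm z" for z
        unfolding norm_mult norm_of_real by (intro mult_right_mono) auto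
      have "norm (of_real (cos ?y - 1) * \<Phi> n x - of_real (sin ?y) * \<Psi> n x) \<le> 3 * (P n * r)"
        using norm_triangle_ineq4[of "of_real (cos ?y - 1) * \<Phi> n x" "of_real (sin ?y) * \<Psi> n x"]
          c[of "\<Phi> n x"] s[of "\<Psi> n x"] * by linarith
      moreover have "norm (of_real (sin ?y) * \<Phi> n x + of_real (cos ?y - 1) * \<Psi> n x) \<le> 3 * (P n * r)"
        using norm_triangle_ineq[of "of_real (sin ?y) * \<Phi> n x" "of_real (cos ?y - 1) * \<Psi> n x"]
          s[of "\<Phi> n x"] c[of "\<Psi> n x"] * by linarith
      moreover have mem: "smul c (E n) + smul c' (E' n) \<in> ?C n"
        if "norm c \<le> 3 * (P n * r)" "norm c' \<le> 3 * (P n * r)" for c c'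
      proof -
        have "smul c (E n) \<in> (\<lambda>c. smul c (E n)) ` ?D n" "smul c' (E' n) \<in> (\<lambda>c. smul c (E' n)) ` ?D n"
          using that by auto
        then show ?thesis by blast
      qed
      ultimately show ?thesis unfolding block_def by (intro mem)
    qed
  qed
qed

text \<open>Biorthogonality leaves only the \<open>m\<close>-th block, so the two coordinates simply
  turn by \<open>t * \<theta> m\<close>.\<close>

lemma
  shows \<Phi>_displacement: "\<Phi> m (x + displacement t x) =
      of_real (cos (t * \<theta> m)) * \<Phi> m x - of_real (sin (t * \<theta> m)) * \<Psi> m x"
    and \<Psi>_displacement: "\<Psi> m (x + displacement t x) =
      of_real (sin (t * \<theta> m)) * \<Phi> m x + of_real (cos (t * \<theta> m)) * \<Psi> m x"
proof -
  have "\<Phi> m (displacement t x) = (\<Sum>n. \<Phi> m (block t n x))"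
    unfolding displacement_def by (rule \<Phi>.suminf[OF summable_block])
  also have "\<dots> = (\<Sum>n. if n = m then
      of_real (cos (t * \<theta> n) - 1) * \<Phi> n x - of_real (sin (t * \<theta> n)) * \<Psi> n x else 0)"
    by (intro suminf_cong) (auto simp: block_def \<Phi>.add bounded_functional_smul[OF functionals(1)] biorthogonal)
  also have "\<dots> = of_real (cos (t * \<theta> m) - 1) * \<Phi> m x - of_real (sin (t * \<theta> m)) * \<Psi> m x"
    by (rule sums_unique[OF sums_single, symmetric])
  finally show "\<Phi> m (x + displacement t x) =
      of_real (cos (t * \<theta> m)) * \<Phi> m x - of_real (sin (t * \<theta> m)) * \<Psi> m x"
    by (simp add: \<Phi>.add algebra_simps)
  have "\<Psi> m (displacement t x) = (\<Sum>n. \<Psi> m (block t n x))"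
    unfolding displacement_def by (rule \<Psi>.suminf[OF summable_block])
  also have "\<dots> = (\<Sum>n. if n = m then
      of_real (sin (t * \<theta> n)) * \<Phi> n x + of_real (cos (t * \<theta> n) - 1) * \<Psi> n x else 0)"
    by (intro suminf_cong) (auto simp: block_def \<Psi>.add bounded_functional_smul[OF functionals(2)] biorthogonal)
  also have "\<dots> = of_real (sin (t * \<theta> m)) * \<Phi> m x + of_real (cos (t * \<theta> m) - 1) * \<Psi> m x"
    by (rule sums_unique[OF sums_single, symmetric])
  finally show "\<Psi> m (x + displacement t x) =
      of_real (sin (t * \<theta> m)) * \<Phi> m x + of_real (cos (t * \<theta> m)) * \<Psi> m x"
    by (simp add: \<Psi>.add algebra_simps)
qed

text \<open>The addition formulas, applied to coordinates that have already turned \<open>t\<close>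
  times; this is the blockwise induction step for the iterates.\<close>

lemma block_displacement: "block t n x + block 1 n (x + displacement t x) = block (Suc t) n x"
proof -
  have a: "real (Suc t) * \<theta> n = real t * \<theta> n + real 1 * \<theta> n" by (simp add: algebra_simps)
  have c: "u + u' = u'' \<Longrightarrow> v + v' = v'' \<Longrightarrow>
      (smul u (E n) + smul v (E' n)) + (smul u' (E n) + smul v' (E' n)) = smul u'' (E n) + smul v'' (E' n)"
    for u u' u'' v v' v''
    by (auto simp: scale_left_distrib)
  show ?thesis
    unfolding block_def \<Phi>_displacement \<Psi>_displacement a cos_add sin_add
    by (rule c) (simp_all add: algebra_simps)
qed

definition rotation :: "'a \<Rightarrow> 'a" where
  "rotation x = x + displacement 1 x"

lemma rotation_iterate: "(rotation ^^ t) x = x + displacement t x"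
proof (induction t)
  case 0
  show ?case by (simp add: displacement_def block_def)
next
  case (Suc t)
  have "displacement t x + displacement 1 (x + displacement t x) = displacement (Suc t) x"
    unfolding displacement_def[of "Suc t" x] block_displacement[symmetric]
    using suminf_add[OF summable_block summable_block, of t x 1 "x + displacement t x"]
    by (simp add: displacement_def)
  moreover have "(rotation ^^ Suc t) x = rotation (x + displacement t x)" by (simp add: Suc)
  ultimately show ?case by (simp only: rotation_def[of "x + displacement t x"] add.assoc)
qed

lemma continuous_linear_operator_rotation: "continuous_linear_operator smul rotation"
proof -
  interpret L: Vector_Spaces.linear smul smul "displacement 1" by (rule linear_displacement)
  have "Vector_Spaces.linear smul smul rotation"
    by unfold_locales (simp_all only: rotation_def L.add L.scale scale_right_distrib add_ac)
  moreover have "continuous_on UNIV rotation"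
    unfolding rotation_def
    by (intro continuous_intros linear_continuous_on bounded_linear_displacement)
  ultimately show ?thesis by (simp add: continuous_linear_operator_def)
qed

end

section \<open>Slow nets and fast periods\<close>

text \<open>The limit inferior of nonnegative terms is nonnegative, so only positive values have to
  be excluded.\<close>

lemma recurrent_set_iff:
  "x \<in> recurrent_set R \<longleftrightarrow> (\<forall>\<epsilon>>0. \<exists>\<^sub>F t in sequentially. norm ((R ^^ t) x - x) < \<epsilon>)"
proof -
  define g where "g t = norm ((R ^^ t) x - x)" for t
  have nonneg: "0 \<le> liminf (\<lambda>t. ereal (g t))"
    by (rule Liminf_bounded) (simp add: g_def)
  have "liminf (\<lambda>t. ereal (g t)) = 0 \<longleftrightarrow> (\<forall>\<epsilon>>0. \<exists>\<^sub>F t in sequentially. g t < \<epsilon>)"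
  proof
    assume 0: "liminf (\<lambda>t. ereal (g t)) = 0"
    show "\<forall>\<epsilon>>0. \<exists>\<^sub>F t in sequentially. g t < \<epsilon>"
    proof (intro allI impI, rule ccontr)
      fix \<epsilon> :: real assume "\<epsilon> > 0" "\<not> (\<exists>\<^sub>F t in sequentially. g t < \<epsilon>)"
      then have "\<forall>\<^sub>F t in sequentially. ereal \<epsilon> \<le> ereal (g t)"
        by (simp add: not_frequently not_less)
      then have "ereal \<epsilon> \<le> liminf (\<lambda>t. ereal (g t))" by (rule Liminf_bounded)
      then show False using 0 \<open>\<epsilon> > 0\<close> by simp
    qed
  next
    assume freq: "\<forall>\<epsilon>>0. \<exists>\<^sub>F t in sequentially. g t < \<epsilon>"
    show "liminf (\<lambda>t. ereal (g t)) = 0"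
    proof (rule ccontr)
      assume "liminf (\<lambda>t. ereal (g t)) \<noteq> 0"
      then have "0 < liminf (\<lambda>t. ereal (g t))" using nonneg by simp
      then obtain c where c: "ereal 0 < ereal c" "ereal c < liminf (\<lambda>t. ereal (g t))"
        using ereal_dense2[of 0 "liminf (\<lambda>t. ereal (g t))"] by auto
      have "\<forall>\<^sub>F t in sequentially. ereal c < ereal (g t)" using less_LiminfD[OF c(2)] .
      then have "\<forall>\<^sub>F t in sequentially. \<not> g t < c" by eventually_elim simp
      then show False using freq c(1) by (simp add: frequently_def)
    qed
  qed
  then show ?thesis by (simp add: recurrent_set_def g_def)
qed

text \<open>Returns to within distance 1 of \<open>x\<close> keep the norm of the orbit below
  \<open>norm x + 1\<close> infinitely often.\<close>

lemma escaping_recurrent_disjoint: "escaping_set R \<inter> recurrent_set R = {}"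
proof -
  have False if x: "x \<in> escaping_set R" "x \<in> recurrent_set R" for x
  proof -
    have "\<forall>\<^sub>F t in sequentially. norm x + 1 \<le> norm ((R ^^ t) x)"
      using x(1) by (simp add: escaping_set_def filterlim_at_top)
    then have "\<forall>\<^sub>F t in sequentially. \<not> norm ((R ^^ t) x - x) < 1"
    proof eventually_elim
      case (elim t)
      then show ?case using norm_triangle_sub[of "(R ^^ t) x" x] by linarith
    qed
    then show False using x(2) unfolding recurrent_set_iff frequently_def by (metis zero_less_one)
  qed
  then show ?thesis by blast
qed

text \<open>Enumerate finite nets of mesh \<open>1 / (j + 1)\<^sup>2\<close> of the unit ball, level \<open>j\<close> by level \<open>j\<close>
  but in any order; \<open>K\<close> is essentially the level.\<close>
lemma slow_net_enumeration:
  obtains r :: "nat \<Rightarrow> 'k::{real_normed_field,heine_borel}" and K :: "nat \<Rightarrow> real"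
  where "\<And>n. norm (r n) \<le> 1" "\<And>n. 0 \<le> K n" "\<And>n. K n \<le> real n + 1"
    "filterlim K at_top sequentially"
    "\<And>s \<epsilon>. norm s \<le> 1 \<Longrightarrow> \<epsilon> > 0 \<Longrightarrow> \<exists>\<^sub>F n in sequentially. K n * norm (s - r n) < \<epsilon>"
proof -
  have "\<exists>G. finite G \<and> G \<subseteq> cball (0::'k) 1 \<and> cball 0 1 \<subseteq> (\<Union>c\<in>G. ball c (1 / (real j + 1)\<^sup>2))" for j :: nat
  proof (rule compactE_image[of "cball (0::'k) 1" "cball 0 1" "\<lambda>c. ball c (1 / (real j + 1)\<^sup>2)"])
    have "(real j + 1)\<^sup>2 > 0" by (simp add: zero_less_power)
    then show "cball (0::'k) 1 \<subseteq> (\<Union>c\<in>cball 0 1. ball c (1 / (real j + 1)\<^sup>2))" by force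
  qed (auto intro: that)
  then obtain G where G: "\<And>j. finite (G j)" "\<And>j. G j \<subseteq> cball (0::'k) 1"
    "\<And>j. cball 0 1 \<subseteq> (\<Union>c\<in>G j. ball c (1 / (real j + 1)\<^sup>2))" by metis
  define T where "T = Sigma UNIV G"
  have near: "\<exists>c. (j, c) \<in> T \<and> norm (s - c) < 1 / (real j + 1)\<^sup>2" if "norm s \<le> 1" for s j
    using G(3)[of j] that unfolding T_def by (fastforce simp: dist_norm norm_minus_commute)
  have "\<exists>c. (j, c) \<in> T" for j using near[of 0 j] by auto
  then have "fst ` T = UNIV" by (force simp: image_iff)
  then have "infinite T" by (metis finite_imageI infinite_UNIV_nat)
  moreover have "countable T" unfolding T_def using G(1) by (auto intro: countable_finite)
  ultimately have h: "bij_betw (from_nat_into T) UNIV T" by (rule bij_betw_from_nat_into[rotated])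
  define h where "h = from_nat_into T"
  have hT: "h n \<in> T" for n
    using h unfolding h_def bij_betw_def by blast
  have inj: "inj h"
    using h unfolding h_def bij_betw_def by blast
  have surj: "\<exists>n. h n = q" if "q \<in> T" for q
    using h that unfolding h_def bij_betw_def by (metis imageE)
  \<comment> \<open>The cap \<open>real n + 1\<close> gives the growth bound needed for summability
    whatever the order of enumeration, and keeps \<open>K\<close> divergent.\<close>
  define K where "K n = min (real (fst (h n))) (real n + 1)" for n
  show thesis
  proof (rule that[of "\<lambda>n. snd (h n)" K])
    show "norm (snd (h n)) \<le> 1" for n
      using hT[of n] G(2)[of "fst (h n)"] unfolding T_def by (cases "h n") auto
    show "filterlim K at_top sequentially"
      unfolding filterlim_at_top
    proof
      fix Z :: real
      obtain j where j: "Z \<le> real j" using real_arch_simple by blast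
      have "finite {n. h n \<in> Sigma {..<j} G}"
        using finite_vimageI[OF _ inj, of "Sigma {..<j} G"] G(1) by (simp add: vimage_def)
      then have "\<forall>\<^sub>F n in sequentially. h n \<notin> Sigma {..<j} G"
        unfolding cofinite_eq_sequentially[symmetric] eventually_cofinite not_not .
      then show "\<forall>\<^sub>F n in sequentially. Z \<le> K n"
        using eventually_ge_at_top[of j]
      proof eventually_elim
        case (elim n)
        then have "j \<le> fst (h n)" using hT[of n] by (cases "h n") (auto simp: T_def not_less)
        then show ?case using elim(2) j by (simp add: K_def)
      qed
    qed
    fix s :: 'k and \<epsilon> :: real assume s: "norm s \<le> 1" and "\<epsilon> > 0"
    show "\<exists>\<^sub>F n in sequentially. K n * norm (s - snd (h n)) < \<epsilon>"
      unfolding frequently_sequentially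
    proof
      fix m
      obtain j1 where j1: "1 / \<epsilon> \<le> real j1" using real_arch_simple by blast
      \<comment> \<open>Exceeding every level met before \<open>m\<close> forces the index of the
        chosen pair to be at least \<open>m\<close>, and \<open>j \<ge> 1 / \<epsilon>\<close> makes
        the product at most \<open>1 / (j + 1) < \<epsilon>\<close>.\<close>
      define j where "j = max j1 (Suc (Max (insert 0 (fst ` h ` {..<m}))))"
      have "fst (h i) \<noteq> j" if "i < m" for i
      proof -
        have "fst (h i) \<le> Max (insert 0 (fst ` h ` {..<m}))" using that by (intro Max_ge) auto
        then show ?thesis by (simp add: j_def)
      qed
      moreover obtain c where c: "(j, c) \<in> T" "norm (s - c) < 1 / (real j + 1)\<^sup>2"
        using near[OF s] by blast
      moreover obtain n where n: "h n = (j, c)" using surj[OF c(1)] by blast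
      ultimately have "m \<le> n" by (metis fst_conv not_less)
      have "K n * norm (s - c) \<le> (real j + 1) * (1 / (real j + 1)\<^sup>2)"
        using c(2) n by (intro mult_mono) (auto simp: K_def)
      also have "\<dots> = 1 / (real j + 1)" by (simp add: power2_eq_square)
      also have "\<dots> < \<epsilon>"
      proof -
        have "1 / \<epsilon> < real j + 1" using j1 by (simp add: j_def)
        then show ?thesis using \<open>\<epsilon> > 0\<close> by (simp add: field_simps)
      qed
      finally show "\<exists>n\<ge>m. K n * norm (s - snd (h n)) < \<epsilon>" using \<open>m \<le> n\<close> n by force
    qed
  qed (simp_all add: K_def)
qed

section \<open>Elementary estimates for the sine, the periods and the weights\<close>

lemma sin_ge_half: "x / 2 \<le> sin x" if "0 \<le> x" "x \<le> pi / 3" for x :: real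
proof (cases "x = 0")
  case False
  then have "0 < x" using that by simp
  then obtain z where z: "0 < z" "z < x" "sin x - sin 0 = (x - 0) * cos z"
    using MVT2[of 0 x sin cos] DERIV_sin by blast
  \<comment> \<open>Up to \<open>pi / 3\<close> the derivative of the sine is at least 1/2.\<close>
  have "cos (pi / 3) \<le> cos z"
    using z that by (intro cos_monotone_0_pi_le) auto
  then have "x * (1 / 2) \<le> x * cos z" using that by (intro mult_left_mono) (auto simp: cos_60)
  then show ?thesis using z by simp
qed simp

text \<open>The quadratic exponent gives divisibility together with geometrically growing ratios of
  consecutive periods, which absorb the linear growth allowed for \<open>K\<close>.\<close>

definition period :: "nat \<Rightarrow> nat" where "period n = 2 ^ (n\<^sup>2)"

lemma period_pos: "0 < period n" by (simp add: period_def)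

lemma period_dvd: "m \<le> n \<Longrightarrow> period m dvd period n"
  unfolding period_def by (intro le_imp_power_dvd power_mono) auto

lemma period_mono: "m \<le> n \<Longrightarrow> period m \<le> period n"
  using period_dvd period_pos dvd_imp_le by blast

lemma period_ge: "n \<le> period n"
proof -
  have "n < 2 ^ n" by (rule less_exp)
  also have "\<dots> \<le> period n" unfolding period_def by (intro power_increasing) (auto simp: power2_eq_square)
  finally show ?thesis by simp
qed

text \<open>On exponents, \<open>m^2 - n^2 = (m - n) * (m + n) \<ge> m\<close>.\<close>

lemma period_ratio:
  assumes "n < m" shows "real (period n) / real (period m) \<le> 1 / 2 ^ m"
proof -
  obtain k where k: "m = n + Suc k" using assms less_iff_Suc_add by auto
  have "n\<^sup>2 + m \<le> m\<^sup>2" by (simp add: k power2_eq_square algebra_simps)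
  then have "period n * 2 ^ m \<le> period m"
    unfolding period_def power_add[symmetric] by (intro power_increasing) auto
  then have "real (period n * 2 ^ m) \<le> real (period m)" by (rule of_nat_mono)
  then have "real (period n) * 2 ^ m \<le> real (period m)" by simp
  then show ?thesis using period_pos[of m] by (simp add: field_simps)
qed

lemma period_bracket:
  assumes "1 \<le> t" obtains n where "period n \<le> t" "t < period (Suc n)"
proof -
  have "\<exists>n. t < period n" using period_ge[of "Suc t"] by (meson Suc_le_lessD)
  then have "t < period (LEAST n. t < period n)" by (rule LeastI_ex)
  moreover have "\<not> t < period 0" using assms by (simp add: period_def)
  ultimately obtain n where n: "(LEAST n. t < period n) = Suc n" by (metis not0_implies_Suc)
  then have "\<not> t < period n" using not_less_Least[of n "\<lambda>n. t < period n"] by simp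
  then show thesis using that[of n] \<open>t < period (LEAST n. t < period n)\<close> n by simp
qed

text \<open>A common majorant of \<open>K n / 2 ^ n\<close> and \<open>1 / 2 ^ n\<close>, summable
  as the derived geometric series at 1/2.\<close>

definition weight :: "nat \<Rightarrow> real" where "weight n = (real n + 1) / 2 ^ n"

lemma summable_weight: "summable weight"
proof -
  have "(\<lambda>n. real (Suc n) * (1/2) ^ n) sums (1 / (1 - 1/2)^2)"
    by (rule geometric_deriv_sums) simp
  then show ?thesis unfolding weight_def[abs_def] by (auto simp: sums_iff field_simps)
qed

section \<open>Escaping and recurrent orbits\<close>

locale competing_rotations = normed_space_hahn_banach smul
  for smul :: "'k::{real_normed_field,heine_borel} \<Rightarrow> 'a::banach \<Rightarrow> 'a" +
  fixes e :: "nat \<Rightarrow> 'a" and f :: "nat \<Rightarrow> 'a \<Rightarrow> 'k" and r :: "nat \<Rightarrow> 'k" and K :: "nat \<Rightarrow> real"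
  assumes norm_e: "norm (e n) = 1" and functional_f: "bounded_functional 10 (f n)"
    and f_e: "f m (e n) = (if m = n then 1 else 0)"
    and norm_r: "norm (r n) \<le> 1" and K_nonneg: "0 \<le> K n" and K_le: "K n \<le> real n + 1"
    and K_top: "filterlim K at_top sequentially"
    and r_dense: "\<lbrakk>norm s \<le> 1; \<epsilon> > 0\<rbrakk> \<Longrightarrow> \<exists>\<^sub>F n in sequentially. K n * norm (s - r n) < \<epsilon>"
begin

text \<open>The offset 2 reserves the indices 0 and 1 for the two functionals that decide the fate
  of an orbit.\<close>

definition E :: "nat \<Rightarrow> 'a" where "E n = e (2 * n + 2)"

definition E' :: "nat \<Rightarrow> 'a" where "E' n = e (2 * n + 3)"

definition u :: "nat \<Rightarrow> 'a \<Rightarrow> 'k" where "u n x = f 0 x - r n * f 1 x"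

text \<open>Chosen so that \<open>C n * (period n * \<theta> n) = 2 * pi * K n\<close>: turning for
  time \<open>period n\<close> about a centre at distance \<open>C n * norm (u n x)\<close> moves a
  point by the order of \<open>K n * norm (u n x)\<close>.\<close>

definition C :: "nat \<Rightarrow> real" where "C n = K n * period (Suc n) / period n"

definition \<theta> :: "nat \<Rightarrow> real" where "\<theta> n = 2 * pi / period (Suc n)"

text \<open>Measuring block \<open>n\<close> by \<open>\<Phi> n\<close> instead of \<open>f (2 * n + 2)\<close> means that it rotates about the point
  \<open>C n * u n x\<close> of the first axis instead of the origin.\<close>
definition \<Phi> :: "nat \<Rightarrow> 'a \<Rightarrow> 'k" where
  "\<Phi> n x = f (2 * n + 2) x - of_real (C n) * u n x"

definition \<Psi> :: "nat \<Rightarrow> 'a \<Rightarrow> 'k" where "\<Psi> n = f (2 * n + 3)"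

lemma norm_f: "norm (f n x) \<le> 10 * norm x"
  using functional_f by (rule bounded_functional_norm)

lemma C_nonneg: "0 \<le> C n"
  by (simp add: C_def K_nonneg)

lemma \<theta>_pos: "0 < \<theta> n"
  by (simp add: \<theta>_def period_pos)

lemma norm_u: "norm (u n x) \<le> 20 * norm x"
proof -
  have "norm (r n * f 1 x) \<le> 1 * (10 * norm x)"
    unfolding norm_mult by (intro mult_mono norm_r norm_f) auto
  then show ?thesis
    using norm_triangle_ineq4[of "f 0 x" "r n * f 1 x"] norm_f[of 0 x] by (simp add: u_def)
qed

lemma norm_\<Phi>: "norm (\<Phi> n x) \<le> 10 * norm x + C n * norm (u n x)"
  using norm_triangle_ineq4[of "f (2 * n + 2) x" "of_real (C n) * u n x"] norm_f[of "2 * n + 2" x]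
  by (simp add: \<Phi>_def norm_mult C_nonneg)

lemma C_\<theta>: "C n * \<theta> n = 2 * pi * K n / period n"
  using period_pos[of "Suc n"] by (simp add: C_def \<theta>_def)

lemma inverse_period_le: "1 / real (period n) \<le> 1 / 2 ^ n"
proof (cases n)
  case (Suc k)
  have "1 / real (period n) \<le> real (period 0) / real (period n)" by (simp add: period_def)
  also have "\<dots> \<le> 1 / 2 ^ n" by (rule period_ratio) (simp add: Suc)
  finally show ?thesis .
qed (simp add: period_def)

lemma K_le_weight: "K n / 2 ^ n \<le> weight n" "1 / 2 ^ n \<le> weight n"
  by (auto simp: weight_def K_le intro!: divide_right_mono)

lemma inverse_period_Suc_le: "1 / real (period (Suc n)) \<le> 1 / real (period n)"
  using period_mono[of n "Suc n"] period_pos[of n] by (intro frac_le) auto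

text \<open>\<open>C n\<close> may be large, but \<open>C n * \<theta> n\<close> is only
  \<open>2 * pi * K n / period n\<close>. The terms contribute \<open>20 * pi\<close> and
  \<open>40 * pi\<close>.\<close>

lemma angle_bound: "\<bar>\<theta> n\<bar> * (10 + 20 * C n) \<le> 60 * pi * weight n"
proof -
  have "\<theta> n \<le> 2 * pi * (1 / period n)"
    using inverse_period_Suc_le[of n] by (simp add: \<theta>_def divide_simps period_pos)
  also have "\<dots> \<le> 2 * pi * weight n"
    using inverse_period_le[of n] K_le_weight(2)[of n] by (intro mult_left_mono) auto
  finally have 1: "\<theta> n \<le> 2 * pi * weight n" .
  have "C n * \<theta> n = 2 * pi * (K n * (1 / period n))" by (simp add: C_\<theta>)
  also have "\<dots> \<le> 2 * pi * (K n * (1 / 2 ^ n))"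
    by (intro mult_left_mono inverse_period_le K_nonneg) auto
  also have "\<dots> \<le> 2 * pi * weight n" using K_le_weight(1)[of n] by (intro mult_left_mono) auto
  finally have "C n * \<theta> n \<le> 2 * pi * weight n" .
  then show ?thesis using 1 \<theta>_pos[of n] by (simp add: algebra_simps)
qed

sublocale rotation_system smul E E' \<Phi> \<Psi> "\<lambda>n. 10 + 20 * C n" \<theta>
proof
  fix m n
  show "norm (E n) = 1" "norm (E' n) = 1" by (simp_all add: E_def E'_def norm_e)
  note f = functional_f
  have "norm (\<Phi> n x) \<le> (10 + 20 * C n) * norm x" for x
    using norm_\<Phi>[of n x] mult_left_mono[OF norm_u[of n x] C_nonneg[of n]]
    by (simp add: algebra_simps)
  then show "bounded_functional (10 + 20 * C n) (\<Phi> n)"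
    unfolding bounded_functional_def \<Phi>_def u_def
    by (simp add: bounded_functional_add[OF f] bounded_functional_smul[OF f] algebra_simps)
  have "norm (\<Psi> n x) \<le> (10 + 20 * C n) * norm x" for x
    using norm_f[of "2 * n + 3" x] mult_nonneg_nonneg[OF C_nonneg[of n] norm_ge_zero[of x]]
    by (simp add: \<Psi>_def distrib_right)
  then show "bounded_functional (10 + 20 * C n) (\<Psi> n)"
    using f[of "2 * n + 3"] by (simp add: bounded_functional_def \<Psi>_def)
  \<comment> \<open>\<open>u m\<close> vanishes on all the planes, since \<open>f 0\<close> and
    \<open>f 1\<close> kill every later \<open>e k\<close>; recentring thus keeps
    biorthogonality.\<close>
  show "\<Phi> m (E n) = (if m = n then 1 else 0)" "\<Phi> m (E' n) = 0"
    "\<Psi> m (E n) = 0" "\<Psi> m (E' n) = (if m = n then 1 else 0)"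
    by (auto simp: E_def E'_def \<Phi>_def \<Psi>_def u_def f_e) presburger+
next
  show "summable (\<lambda>n. \<bar>\<theta> n\<bar> * (10 + 20 * C n))"
    by (rule summable_comparison_test'[OF summable_mult[OF summable_weight, of "60 * pi"], of 0])
      (use angle_bound C_nonneg in auto)
qed

text \<open>Blocks before \<open>n\<close> have made full turns, block \<open>n\<close> contributes
  the \<open>u\<close> term, and the later ones turn so little that they form a summable
  tail.\<close>

lemma norm_displacement_le:
  "norm (displacement (period n) x) \<le>
     4 * pi * (K n * norm (u n x)) + 160 * pi * norm x * (\<Sum>m. weight (m + n))"
proof -
  let ?c = "4 * pi * (K n * norm (u n x))"
  have early: "block (period n) m x = 0" if "m < n" for m
  proof -
    obtain k where k: "period n = period (Suc m) * k" using period_dvd[of "Suc m" n] \<open>m < n\<close> by auto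
    then have "real (period n) * \<theta> m = 2 * real k * pi"
      using period_pos[of "Suc m"] by (simp add: \<theta>_def)
    then show ?thesis by (simp add: block_def)
  qed
  have gen: "norm (block (period n) m x) \<le>
      80 * pi * norm x * (period n / period (Suc m)) + 4 * pi * (period n / period m) * (K m * norm (u m x))" for m
  proof -
    have "norm (block (period n) m x) \<le> 2 * period n * \<theta> m * (norm (\<Phi> m x) + norm (\<Psi> m x))"
      using norm_block[of "period n" m x] \<theta>_pos[of m] by simp
    also have "\<dots> \<le> 2 * period n * \<theta> m * ((10 * norm x + C m * norm (u m x)) + 10 * norm x)"
      using \<theta>_pos[of m] norm_\<Phi> norm_f by (intro mult_left_mono add_mono) (auto simp: \<Psi>_def)
    also have "\<dots> = 40 * period n * norm x * \<theta> m + 2 * period n * norm (u m x) * (C m * \<theta> m)"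
      by (simp add: algebra_simps)
    also have "\<dots> = 80 * pi * norm x * (period n / period (Suc m)) + 4 * pi * (period n / period m) * (K m * norm (u m x))"
      unfolding C_\<theta> by (simp add: \<theta>_def mult_ac)
    finally show ?thesis .
  qed
  \<comment> \<open>The centre term is kept for block \<open>n\<close>. For later blocks
    \<open>norm_u\<close> and the period ratio turn it into a second \<open>80 * pi\<close>, whence
    160.\<close>
  have late: "norm (block (period n) (m + n) x) \<le>
      160 * pi * norm x * weight (m + n) + (if m = 0 then ?c else 0)" for m
  proof -
    have "real (period n) / period (Suc (m + n)) \<le> 1 / 2 ^ Suc (m + n)" by (rule period_ratio) simp
    also have "\<dots> \<le> 1 / 2 ^ (m + n)" by (simp add: field_simps)
    also have "\<dots> \<le> weight (m + n)" by (rule K_le_weight)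
    finally have 1: "80 * pi * norm x * (period n / period (Suc (m + n))) \<le> 80 * pi * norm x * weight (m + n)"
      by (intro mult_left_mono) auto
    show ?thesis
    proof (cases m)
      case 0
      have "0 \<le> 80 * pi * norm x * weight (m + n)" by (simp add: weight_def)
      then show ?thesis using 1 gen[of "m + n"] period_pos[of n] 0 by (simp add: mult_ac)
    next
      case (Suc j)
      have "(period n / period (m + n)) * (K (m + n) * norm (u (m + n) x)) \<le>
          1 / 2 ^ (m + n) * (K (m + n) * (20 * norm x))"
        using K_nonneg norm_u Suc by (intro mult_mono mult_left_mono period_ratio) auto
      also have "\<dots> = (20 * norm x) * (K (m + n) / 2 ^ (m + n))" by simp
      also have "\<dots> \<le> (20 * norm x) * weight (m + n)" by (intro mult_left_mono K_le_weight) auto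
      finally have "4 * pi * ((period n / period (m + n)) * (K (m + n) * norm (u (m + n) x)))
          \<le> 4 * pi * ((20 * norm x) * weight (m + n))" by (intro mult_left_mono) auto
      then show ?thesis using 1 gen[of "m + n"] Suc by (simp add: mult_ac)
    qed
  qed
  have sw: "summable (\<lambda>m. 160 * pi * norm x * weight (m + n))"
    using summable_weight by (intro summable_mult) simp
  have single: "(\<lambda>m. if m = 0 then ?c else 0) sums ?c" by (rule sums_single)
  have "displacement (period n) x = (\<Sum>m. block (period n) (m + n) x)"
    using suminf_split_initial_segment[OF summable_block, of "period n" x n] early
    by (simp add: displacement_def)
  then have "norm (displacement (period n) x) \<le>
      (\<Sum>m. 160 * pi * norm x * weight (m + n) + (if m = 0 then ?c else 0))"
    using late sw single by (auto intro!: norm_suminf_le summable_add dest: sums_summable)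
  also have "\<dots> = (\<Sum>m. 160 * pi * norm x * weight (m + n)) + ?c"
    using suminf_add[OF sw sums_summable[OF single]] sums_unique[OF single] by simp
  also have "(\<Sum>m. 160 * pi * norm x * weight (m + n)) = 160 * pi * norm x * (\<Sum>m. weight (m + n))"
    using summable_weight by (intro suminf_mult) simp
  finally show ?thesis by simp
qed

text \<open>The returns occur at times \<open>period n\<close> for infinitely many suitable
  \<open>n\<close>: half of \<epsilon> is spent on the \<open>u\<close> term, half on the
  tail.\<close>

lemma recurrent:
  assumes "norm (f 0 x) \<le> norm (f 1 x)"
  shows "x \<in> recurrent_set rotation"
  unfolding recurrent_set_iff
proof (intro allI impI)
  fix \<epsilon> :: real assume "\<epsilon> > 0"
  have freq: "\<exists>\<^sub>F n in sequentially. K n * norm (u n x) < \<epsilon> / (8 * pi)"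
  proof (cases "f 1 x = 0")
    case True
    then have "u n x = 0" for n using assms by (simp add: u_def)
    then show ?thesis using \<open>\<epsilon> > 0\<close> by simp
  next
    case False
    \<comment> \<open>Since \<open>u n x = (s - r n) * f 1 x\<close>, approximating \<open>s\<close>
      by \<open>r n\<close> makes the \<open>u\<close> term small.\<close>
    define s where "s = f 0 x / f 1 x"
    have "norm s \<le> 1" using assms False by (simp add: s_def norm_divide)
    then have "\<exists>\<^sub>F n in sequentially. K n * norm (s - r n) < \<epsilon> / (8 * pi) / norm (f 1 x)"
      using \<open>\<epsilon> > 0\<close> False by (intro r_dense) auto
    then show ?thesis
    proof (rule frequently_elim1)
      fix n assume *: "K n * norm (s - r n) < \<epsilon> / (8 * pi) / norm (f 1 x)"
      have "u n x = (s - r n) * f 1 x" using False by (simp add: u_def s_def left_diff_distrib)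
      then have "K n * norm (u n x) = K n * norm (s - r n) * norm (f 1 x)" by (simp add: norm_mult)
      also have "\<dots> < \<epsilon> / (8 * pi)"
        using * False pos_less_divide_eq[of "norm (f 1 x)"] by (metis zero_less_norm_iff)
      finally show "K n * norm (u n x) < \<epsilon> / (8 * pi)" .
    qed
  qed
  have "(\<lambda>n. 160 * pi * norm x * (suminf weight - (\<Sum>m<n. weight m))) \<longlonglongrightarrow> 160 * pi * norm x * (suminf weight - suminf weight)"
    by (intro tendsto_intros summable_LIMSEQ summable_weight)
  then have "\<forall>\<^sub>F n in sequentially. 160 * pi * norm x * (suminf weight - (\<Sum>m<n. weight m)) < \<epsilon> / 2"
    using \<open>\<epsilon> > 0\<close> by (intro order_tendstoD) auto
  then have tail: "\<forall>\<^sub>F n in sequentially. 160 * pi * norm x * (\<Sum>m. weight (m + n)) < \<epsilon> / 2"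
    by (simp add: suminf_minus_initial_segment[OF summable_weight])
  show "\<exists>\<^sub>F t in sequentially. norm ((rotation ^^ t) x - x) < \<epsilon>"
    unfolding frequently_sequentially
  proof
    fix m
    have "\<exists>\<^sub>F n in sequentially.
        160 * pi * norm x * (\<Sum>m. weight (m + n)) < \<epsilon> / 2 \<and> K n * norm (u n x) < \<epsilon> / (8 * pi)"
      using freq tail by (rule frequently_eventually_conj)
    then obtain n where n: "n \<ge> m" "K n * norm (u n x) < \<epsilon> / (8 * pi)"
      "160 * pi * norm x * (\<Sum>m. weight (m + n)) < \<epsilon> / 2"
      unfolding frequently_sequentially by blast
    have "4 * pi * (K n * norm (u n x)) < 4 * pi * (\<epsilon> / (8 * pi))"
      using n(2) by (intro mult_strict_left_mono) auto
    then have "norm ((rotation ^^ period n) x - x) < \<epsilon>"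
      using norm_displacement_le[of n x] n(3) by (simp add: rotation_iterate)
    then show "\<exists>t\<ge>m. norm ((rotation ^^ t) x - x) < \<epsilon>"
      using n(1) period_ge[of n] by (meson order_trans)
  qed
qed

text \<open>The coordinate \<open>\<Psi> n\<close> of the orbit picks up the sine of the angle times
  \<open>\<Phi> n x\<close>, which is \<open>C n * norm (u n x)\<close> up to
  \<open>10 * norm x\<close>. The factor 6 puts the angle between
  \<open>period n / period (Suc n)\<close>, as 2 * pi >= 6, and \<open>pi / 3\<close>; hence
  \<open>C n\<close> times the sine is at least \<open>K n / 2\<close>.\<close>

lemma orbit_lower_bound:
  assumes t: "period n \<le> 6 * t" "6 * t < period (Suc n)"
  shows "K n * norm (u n x) / 2 - 20 * norm x \<le> 10 * norm ((rotation ^^ t) x)"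
proof -
  let ?y = "real t * \<theta> n"
  have t': "real (period n) \<le> 6 * real t" "6 * real t \<le> real (period (Suc n))"
    using t by linarith+
  have y: "?y \<le> pi / 3"
    using t'(2) period_pos[of "Suc n"] by (simp add: \<theta>_def field_simps)
  have "period n / period (Suc n) \<le> ?y"
  proof -
    have "real (period n) \<le> (2 * pi) * real t"
      using t'(1) mult_right_mono[of 6 "2 * pi" "real t"] pi_gt3 by linarith
    then show ?thesis using period_pos[of "Suc n"] by (simp add: \<theta>_def field_simps)
  qed
  then have "period n / period (Suc n) / 2 \<le> sin ?y"
    using sin_ge_half[of ?y] y \<theta>_pos[of n] by simp
  then have "C n * (period n / period (Suc n) / 2) \<le> C n * sin ?y"
    using C_nonneg by (rule mult_left_mono)
  moreover have "C n * (period n / period (Suc n) / 2) = K n / 2"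
    using period_pos[of n] period_pos[of "Suc n"] by (simp add: C_def)
  ultimately have CK: "K n / 2 \<le> C n * sin ?y" by simp
  have s0: "0 \<le> sin ?y" using sin_ge_half[of ?y] y \<theta>_pos[of n] by (smt (verit) divide_nonneg_nonneg mult_nonneg_nonneg of_nat_0_le_iff)
  have "C n * norm (u n x) - 10 * norm x \<le> norm (\<Phi> n x)"
    using norm_triangle_ineq3[of "of_real (C n) * u n x" "f (2 * n + 2) x"] norm_f[of "2 * n + 2" x]
    by (simp add: \<Phi>_def norm_mult C_nonneg norm_minus_commute)
  then have "sin ?y * (C n * norm (u n x) - 10 * norm x) \<le> sin ?y * norm (\<Phi> n x)"
    using s0 by (rule mult_left_mono)
  moreover have "sin ?y * (10 * norm x) \<le> 1 * (10 * norm x)" by (intro mult_right_mono) auto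
  moreover have "K n / 2 * norm (u n x) \<le> C n * sin ?y * norm (u n x)"
    using CK by (rule mult_right_mono) simp
  ultimately have 1: "K n * norm (u n x) / 2 - 10 * norm x \<le> norm (of_real (sin ?y) * \<Phi> n x)"
    using s0 by (simp add: norm_mult algebra_simps)
  have "norm (of_real (cos ?y) * \<Psi> n x) \<le> 1 * (10 * norm x)"
    unfolding norm_mult \<Psi>_def by (intro mult_mono norm_f) auto
  moreover have "norm (of_real (sin ?y) * \<Phi> n x) - norm (of_real (cos ?y) * \<Psi> n x) \<le> norm (\<Psi> n ((rotation ^^ t) x))"
    unfolding rotation_iterate \<Psi>_displacement by (rule norm_diff_ineq)
  moreover have "norm (\<Psi> n ((rotation ^^ t) x)) \<le> 10 * norm ((rotation ^^ t) x)"
    unfolding \<Psi>_def by (rule norm_f)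
  ultimately show ?thesis using 1 by linarith
qed

text \<open>As \<open>norm (r n) \<le> 1\<close>, \<open>norm (u n x)\<close> stays above \<delta>;
  for large \<open>t\<close>, the number \<open>6 * t\<close> lies between consecutive periods of
  large index, where \<open>K\<close> is large.\<close>

lemma escaping:
  assumes "norm (f 1 x) < norm (f 0 x)"
  shows "x \<in> escaping_set rotation"
  unfolding escaping_set_def filterlim_at_top mem_Collect_eq
proof
  fix Z :: real
  define \<delta> where "\<delta> = norm (f 0 x) - norm (f 1 x)"
  have "\<delta> > 0" using assms by (simp add: \<delta>_def)
  have u: "\<delta> \<le> norm (u n x)" for n
  proof -
    have "norm (r n * f 1 x) \<le> 1 * norm (f 1 x)"
      unfolding norm_mult by (intro mult_right_mono norm_r) auto
    then show ?thesis using norm_triangle_ineq2[of "f 0 x" "r n * f 1 x"] by (simp add: u_def \<delta>_def)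
  qed
  have "\<forall>\<^sub>F n in sequentially. 2 * (10 * Z + 20 * norm x) / \<delta> \<le> K n"
    using K_top by (simp add: filterlim_at_top)
  then obtain n0 where n0: "\<And>n. n \<ge> n0 \<Longrightarrow> 2 * (10 * Z + 20 * norm x) / \<delta> \<le> K n"
    by (auto simp: eventually_sequentially)
  show "\<forall>\<^sub>F t in sequentially. Z \<le> norm ((rotation ^^ t) x)"
    using eventually_ge_at_top[of "period n0"]
  proof eventually_elim
    case (elim t)
    then have "1 \<le> 6 * t" using period_pos[of n0] by simp
    then obtain n where n: "period n \<le> 6 * t" "6 * t < period (Suc n)" by (rule period_bracket)
    have "n0 \<le> n"
    proof (rule ccontr)
      assume "\<not> n0 \<le> n"
      then have "period (Suc n) \<le> period n0" by (intro period_mono) simp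
      then show False using n elim by simp
    qed
    then have "2 * (10 * Z + 20 * norm x) \<le> K n * \<delta>"
      using n0 \<open>\<delta> > 0\<close> by (simp add: field_simps)
    also have "\<dots> \<le> K n * norm (u n x)" by (intro mult_left_mono u K_nonneg)
    finally show ?case using orbit_lower_bound[OF n, of x] by simp
  qed
qed

text \<open>The two strict inequalities between \<open>norm (f 0 x)\<close> and
  \<open>norm (f 1 x)\<close> cut out open sets, witnessed by \<open>e 0\<close> and
  \<open>e 1\<close>; the case of equality is recurrent.\<close>

lemma rotation_wild:
  shows "interior (escaping_set rotation) \<noteq> {}" "interior (recurrent_set rotation) \<noteq> {}"
    "escaping_set rotation \<union> recurrent_set rotation = UNIV"
proof -
  have cont: "continuous_on UNIV (f n)" for n
    by (intro linear_continuous_on bounded_functional_bounded_linear[OF functional_f])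
  have "open {x. norm (f 1 x) < norm (f 0 x)}" "open {x. norm (f 0 x) < norm (f 1 x)}"
    by (intro open_Collect_less continuous_on_norm cont)+
  moreover have "{x. norm (f 1 x) < norm (f 0 x)} \<subseteq> escaping_set rotation"
    "{x. norm (f 0 x) < norm (f 1 x)} \<subseteq> recurrent_set rotation"
    using escaping recurrent by auto
  ultimately have "{x. norm (f 1 x) < norm (f 0 x)} \<subseteq> interior (escaping_set rotation)"
    "{x. norm (f 0 x) < norm (f 1 x)} \<subseteq> interior (recurrent_set rotation)"
    by (auto intro: interior_maximal[THEN subsetD])
  moreover have "e 0 \<in> {x. norm (f 1 x) < norm (f 0 x)}" "e 1 \<in> {x. norm (f 0 x) < norm (f 1 x)}"
    by (simp_all add: f_e)
  ultimately show "interior (escaping_set rotation) \<noteq> {}" "interior (recurrent_set rotation) \<noteq> {}"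
    by blast+
  show "escaping_set rotation \<union> recurrent_set rotation = UNIV"
    using escaping recurrent not_less by blast
qed

end

theorem (in normed_space_hahn_banach) exists_wild_operator:
  assumes "infinite_dimensional smul"
  shows "\<exists>R. continuous_linear_operator smul R \<and>
    interior (escaping_set R) \<noteq> {} \<and> interior (recurrent_set R) \<noteq> {} \<and>
    escaping_set R \<union> recurrent_set R = UNIV \<and> escaping_set R \<inter> recurrent_set R = {} \<and>
    (\<exists>K. compact_operator smul K \<and> R = (\<lambda>x. x + K x))"
proof -
  obtain e :: "nat \<Rightarrow> 'a" and f :: "nat \<Rightarrow> 'a \<Rightarrow> 'k" where ef: "\<And>n. norm (e n) = 1"
    "\<And>n. bounded_functional 10 (f n)" "\<And>m n. f m (e n) = (if m = n then 1 else 0)"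
    using bounded_biorthogonal_sequence[OF assms] by blast
  obtain r :: "nat \<Rightarrow> 'k" and K where rK: "\<And>n. norm (r n) \<le> 1" "\<And>n. 0 \<le> K n"
    "\<And>n. K n \<le> real n + 1" "filterlim K at_top sequentially"
    "\<And>s \<epsilon>. norm s \<le> 1 \<Longrightarrow> \<epsilon> > 0 \<Longrightarrow> \<exists>\<^sub>F n in sequentially. K n * norm (s - r n) < \<epsilon>"
    using slow_net_enumeration by blast
  interpret competing_rotations smul e f r K
    by unfold_locales (use ef rK in auto)
  have "rotation = (\<lambda>x. x + displacement 1 x)" by (rule ext) (rule rotation_def)
  then show ?thesis
    using continuous_linear_operator_rotation rotation_wild escaping_recurrent_disjoint
      compact_operator_displacement by blast
qed

theorem theorem1p1:
  fixes cscale :: "complex \<Rightarrow> 'a::banach \<Rightarrow> 'a"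
  assumes "separable_space (euclidean :: 'a topology)"
  shows
    "(infinite_dimensional (scaleR :: real \<Rightarrow> 'a \<Rightarrow> 'a) \<longrightarrow>
      (\<exists>R :: 'a \<Rightarrow> 'a. continuous_linear_operator scaleR R \<and>
         interior (escaping_set R) \<noteq> {} \<and> interior (recurrent_set R) \<noteq> {} \<and>
         escaping_set R \<union> recurrent_set R = UNIV \<and> escaping_set R \<inter> recurrent_set R = {} \<and>
         (\<exists>K. compact_operator scaleR K \<and> R = (\<lambda>x. x + K x))))
     \<and>
     (normed_space_over cscale \<and> infinite_dimensional cscale \<longrightarrow>
      (\<exists>R :: 'a \<Rightarrow> 'a. continuous_linear_operator cscale R \<and>
         interior (escaping_set R) \<noteq> {} \<and> interior (recurrent_set R) \<noteq> {} \<and>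
         escaping_set R \<union> recurrent_set R = UNIV \<and> escaping_set R \<inter> recurrent_set R = {} \<and>
         (\<exists>K. compact_operator cscale K \<and> R = (\<lambda>x. x + K x))))"
  using normed_space_hahn_banach.exists_wild_operator[OF normed_space_hahn_banach_real]
    normed_space_hahn_banach.exists_wild_operator[OF normed_space_hahn_banach_complex]
  by blast

end
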